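(* Let $\mathcal H$ be a (possibly infinite-dimensional) Hilbert space and let $R,S$ be finite non-empty sets of rank-one projections (pure states) on $\mathcal H$. Then $$\mathrm e(R\|S)=\min_{\rho\in R,\,\sigma\in S}\mathrm e(\rho\|\sigma)$$ for each of the exponents $\mathrm e=\mathrm s$ (Stein), $\mathrm e=\mathrm c$ (Chernoff), and $\mathrm e=\mathrm d_r$, $r>0$ (direct).
   Context: For a test $T_n$ (a bounded operator on $\mathcal H^{\otimes n}$ with $0\le T_n\le I$), put $\alpha_n(T_n)=\max_{\rho\in R}\operatorname{Tr}\rho^{\otimes n}(I-T_n)$ and $\beta_n(T_n)=\max_{\sigma\in S}\operatorname{Tr}\sigma^{\otimes n}T_n$. With $\log$ natural and $-\log0=+\infty$: $\mathrm s(R\|S)$ is the supremum of $\liminf_n-\frac1n\log\beta_n(T_n)$ over test sequences with $\lim_n\alpha_n(T_n)=0$; $\mathrm d_r(R\|S)$ is the supremum of $\liminf_n-\frac1n\log\alpha_n(T_n)$ over test sequences with $\liminf_n-\frac1n\log\beta_n(T_n)\ge r$; $\mathrm c(R\|S)$ is the supremum of all $r\ge0$ for which some test sequence satisfies both $\liminf_n-\frac1n\log\alpha_n(T_n)\ge r$ and $\liminf_n-\frac1n\log\beta_n(T_n)\ge r$. $\mathrm e(\rho\|\sigma)=\mathrm e(\{\rho\}\|\{\sigma\})$. *)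

theory Defs
  imports "HOL-Analysis.Analysis"
begin

section \<open>Complex Hilbert spaces\<close>

text \<open>
  The inner product is linear in the second argument; \<^const>\<open>inner\<close> is that of the
  underlying real Hilbert space, so norm and topology are the library's. There is no
  restriction on the dimension.
\<close>

class chilbert_space = real_inner + complete_space +
  fixes scaleC :: "complex \<Rightarrow> 'a \<Rightarrow> 'a"  (infixr \<open>*\<^sub>C\<close> 75)
    and cinner :: "'a \<Rightarrow> 'a \<Rightarrow> complex"
  assumes scaleC_add_right: "a *\<^sub>C (x + y) = a *\<^sub>C x + a *\<^sub>C y"
    and scaleC_add_left: "(a + b) *\<^sub>C x = a *\<^sub>C x + b *\<^sub>C x"
    and scaleC_scaleC: "a *\<^sub>C b *\<^sub>C x = (a * b) *\<^sub>C x"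
    and scaleR_scaleC: "scaleR r x = complex_of_real r *\<^sub>C x"
    and cinner_commute: "cinner x y = cnj (cinner y x)"
    and cinner_add_right: "cinner x (y + z) = cinner x y + cinner x z"
    and cinner_scaleC_right: "cinner x (a *\<^sub>C y) = a * cinner x y"
    and inner_cinner: "inner x y = Re (cinner x y)"
begin

subclass banach ..

lemma scaleC_one: "1 *\<^sub>C x = x"
  by (metis of_real_1 scaleR_one scaleR_scaleC)

end

global_interpretation complex_vector: vector_space "scaleC :: complex \<Rightarrow> 'a \<Rightarrow> 'a::chilbert_space"
  defines cspan = complex_vector.span and cdim = complex_vector.dim and csubspace = complex_vector.subspace
  by unfold_locales (simp_all add: scaleC_add_right scaleC_add_left scaleC_scaleC scaleC_one)

lemma cinner_0_right [simp]: "cinner x 0 = 0"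
  using cinner_add_right[of x 0 0] by simp

lemma cinner_0_left [simp]: "cinner 0 x = 0"
  by (subst cinner_commute) simp

lemma cinner_add_left: "cinner (x + y) z = cinner x z + cinner y z"
  by (metis cinner_commute cinner_add_right complex_cnj_add)

lemma cinner_scaleC_left: "cinner (a *\<^sub>C x) y = cnj a * cinner x y"
  by (metis cinner_commute cinner_scaleC_right complex_cnj_mult)

lemma cinner_minus_right: "cinner x (- y) = - cinner x y"
  using cinner_add_right[of x y "- y"] by (simp add: eq_neg_iff_add_eq_0 add.commute)

lemma cinner_minus_left: "cinner (- x) y = - cinner x y"
  by (metis cinner_commute cinner_minus_right complex_cnj_minus)

lemma cinner_diff_right: "cinner x (y - z) = cinner x y - cinner x z"
  by (metis cinner_add_right cinner_minus_right diff_conv_add_uminus)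

lemma cinner_diff_left: "cinner (x - y) z = cinner x z - cinner y z"
  by (metis cinner_add_left cinner_minus_left diff_conv_add_uminus)

lemma cinner_sum_right: "cinner x (sum f A) = (\<Sum>a\<in>A. cinner x (f a))"
  by (induction A rule: infinite_finite_induct) (simp_all add: cinner_add_right)

lemma cinner_sum_left: "cinner (sum f A) x = (\<Sum>a\<in>A. cinner (f a) x)"
  by (induction A rule: infinite_finite_induct) (simp_all add: cinner_add_left)

lemma cinner_same: "cinner x x = complex_of_real ((norm x)\<^sup>2)"
proof -
  have "Im (cinner x x) = 0"
    using arg_cong[OF cinner_commute[of x x], of Im] by simp
  moreover have "Re (cinner x x) = (norm x)\<^sup>2"
    by (simp add: inner_cinner[symmetric] power2_norm_eq_inner)
  ultimately show ?thesis
    by (simp add: complex_eq_iff)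
qed

lemma norm_scaleC: "norm (a *\<^sub>C x) = cmod a * norm x"
proof -
  have "complex_of_real ((norm (a *\<^sub>C x))\<^sup>2) = a * cnj a * cinner x x"
    unfolding cinner_same[symmetric] cinner_scaleC_left cinner_scaleC_right by (simp only: mult_ac)
  also have "\<dots> = complex_of_real ((cmod a * norm x)\<^sup>2)"
    by (simp only: complex_norm_square[symmetric] cinner_same power_mult_distrib of_real_mult)
  finally have "(norm (a *\<^sub>C x))\<^sup>2 = (cmod a * norm x)\<^sup>2"
    by (simp only: of_real_eq_iff)
  then show ?thesis
    by (rule power2_eq_imp_eq) simp_all
qed

lemma cmod_cinner_le: "cmod (cinner x y) \<le> norm x * norm y"
proof (cases "cinner x y = 0")
  case False
  define u where "u = cnj (sgn (cinner x y))"
  have "cinner x (u *\<^sub>C y) = complex_of_real (cmod (cinner x y))"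
    using False complex_norm_square[of "cinner x y"]
    by (simp add: cinner_scaleC_right u_def sgn_eq power2_eq_square field_simps)
  then have "cmod (cinner x y) = inner x (u *\<^sub>C y)"
    by (simp add: inner_cinner)
  also have "\<dots> \<le> norm x * norm (u *\<^sub>C y)"
    by (rule norm_cauchy_schwarz)
  also have "\<dots> = norm x * norm y"
    using False by (simp add: norm_scaleC u_def norm_sgn)
  finally show ?thesis .
qed simp

lemma bounded_linear_cinner_right: "bounded_linear (cinner x)"
  by (rule bounded_linear_intro[where K = "norm x"])
     (simp_all add: cinner_add_right scaleR_scaleC cinner_scaleC_right scaleR_conv_of_real
       cmod_cinner_le mult.commute[of _ "norm x"])

lemma bounded_linear_cinner_left: "bounded_linear (\<lambda>x. cinner x y)"
  by (rule bounded_linear_intro[where K = "norm y"])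
     (simp_all add: cinner_add_left scaleR_scaleC cinner_scaleC_left scaleR_conv_of_real
       cmod_cinner_le mult.commute)

lemma bounded_linear_scaleC_right: "bounded_linear (scaleC a)"
proof (rule bounded_linear_intro[where K = "cmod a"])
  show "a *\<^sub>C (r *\<^sub>R x) = r *\<^sub>R (a *\<^sub>C x)" for r and x :: 'a
    unfolding scaleR_scaleC scaleC_scaleC by (simp only: mult.commute)
  show "norm (a *\<^sub>C x) \<le> norm x * cmod a" for x :: 'a
    by (simp only: norm_scaleC mult.commute)
qed (rule scaleC_add_right)


section \<open>Square-summable families\<close>

typedef 'i ell2 = "{f :: 'i \<Rightarrow> complex. (\<lambda>i. (cmod (f i))\<^sup>2) summable_on UNIV}"
  morphisms coord Abs_ell2
  by (rule exI[of _ "\<lambda>_. 0"]) simp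

lemma summable_coord: "(\<lambda>i. (cmod (coord f i))\<^sup>2) summable_on UNIV"
  using coord by blast

lemma ell2_eqI: "(\<And>i. coord f i = coord g i) \<Longrightarrow> f = g"
  by (metis coord_inject ext)

lemma abs_summable_sq:
  fixes f g :: "'i \<Rightarrow> complex"
  assumes "(\<lambda>i. (cmod (f i))\<^sup>2) summable_on A" "(\<lambda>i. (cmod (g i))\<^sup>2) summable_on A"
  shows "(\<lambda>i. cmod (f i) * cmod (g i)) summable_on A"
proof (rule summable_on_comparison_test)
  show "(\<lambda>i. (cmod (f i))\<^sup>2 + (cmod (g i))\<^sup>2) summable_on A"
    by (intro summable_on_add assms)
  show "cmod (f i) * cmod (g i) \<le> (cmod (f i))\<^sup>2 + (cmod (g i))\<^sup>2" for i
    using sum_squares_bound[of "cmod (f i)" "cmod (g i)"] 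
      mult_nonneg_nonneg[OF norm_ge_zero norm_ge_zero, of "f i" "g i"]
    by linarith
qed simp

lemma summable_sq_add:
  fixes f g :: "'i \<Rightarrow> complex"
  assumes "(\<lambda>i. (cmod (f i))\<^sup>2) summable_on A" "(\<lambda>i. (cmod (g i))\<^sup>2) summable_on A"
  shows "(\<lambda>i. (cmod (f i + g i))\<^sup>2) summable_on A"
proof (rule summable_on_comparison_test)
  show "(\<lambda>i. (cmod (f i))\<^sup>2 + (cmod (g i))\<^sup>2 + 2 * (cmod (f i) * cmod (g i))) summable_on A"
    by (intro summable_on_add summable_on_cmult_right abs_summable_sq assms)
  show "(cmod (f i + g i))\<^sup>2 \<le> (cmod (f i))\<^sup>2 + (cmod (g i))\<^sup>2 + 2 * (cmod (f i) * cmod (g i))" for i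
    using power_mono[OF norm_triangle_ineq[of "f i" "g i"] norm_ge_zero, of 2]
    by (simp add: power2_sum)
qed simp

lemma summable_sq_scale:
  fixes f :: "'i \<Rightarrow> complex"
  assumes "(\<lambda>i. (cmod (f i))\<^sup>2) summable_on A"
  shows "(\<lambda>i. (cmod (a * f i))\<^sup>2) summable_on A"
  using summable_on_cmult_right[OF assms, of "(cmod a)\<^sup>2"] by (simp add: norm_mult power_mult_distrib)

instantiation ell2 :: (type) real_vector
begin

definition "0 = Abs_ell2 (\<lambda>_. 0)"
definition "f + g = Abs_ell2 (\<lambda>i. coord f i + coord g i)"
definition "- f = Abs_ell2 (\<lambda>i. - coord f i)" for f :: "'a ell2"
definition "f - g = Abs_ell2 (\<lambda>i. coord f i - coord g i)"
definition "scaleR r f = Abs_ell2 (\<lambda>i. of_real r * coord f i)"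

lemma coord_zero [simp]: "coord 0 i = 0"
  by (simp add: zero_ell2_def Abs_ell2_inverse)

lemma coord_add [simp]: "coord (f + g) i = coord f i + coord g i"
  using summable_sq_add[OF summable_coord[of f] summable_coord[of g]]
  by (simp add: plus_ell2_def Abs_ell2_inverse)

lemma coord_uminus [simp]: "coord (- f) i = - coord f i"
  using summable_coord[of f] by (simp add: uminus_ell2_def Abs_ell2_inverse)

lemma coord_diff [simp]: "coord (f - g) i = coord f i - coord g i"
  using summable_sq_add[OF summable_coord[of f] summable_coord[of "- g"]]
  by (simp add: minus_ell2_def Abs_ell2_inverse)

lemma coord_scaleR [simp]: "coord (scaleR r f) i = of_real r * coord f i"
  using summable_sq_scale[OF summable_coord[of f], of "of_real r"]
  by (simp add: scaleR_ell2_def Abs_ell2_inverse)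

instance
  by standard (rule ell2_eqI, simp add: distrib_left distrib_right)+

end

lemma ell2_abs_summable: "(\<lambda>i. norm (cnj (coord f i) * coord g i)) summable_on A"
  using abs_summable_sq[OF summable_on_subset_banach[OF summable_coord[of f], of A]
      summable_on_subset_banach[OF summable_coord[of g], of A]]
  by (simp add: norm_mult)

lemma ell2_summable: "(\<lambda>i. cnj (coord f i) * coord g i) summable_on A"
  by (rule abs_summable_summable[OF ell2_abs_summable])

instantiation ell2 :: (type) real_inner
begin

definition inner_ell2 :: "'a ell2 \<Rightarrow> 'a ell2 \<Rightarrow> real"
  where "inner_ell2 f g = Re (\<Sum>\<^sub>\<infinity>i. cnj (coord f i) * coord g i)"
definition norm_ell2 :: "'a ell2 \<Rightarrow> real" where "norm_ell2 f = sqrt (inner f f)"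
definition sgn_ell2 :: "'a ell2 \<Rightarrow> 'a ell2" where "sgn_ell2 f = inverse (norm f) *\<^sub>R f"
definition dist_ell2 :: "'a ell2 \<Rightarrow> 'a ell2 \<Rightarrow> real" where "dist_ell2 f g = norm (f - g)"
definition uniformity_ell2 :: "('a ell2 \<times> 'a ell2) filter"
  where "uniformity_ell2 = (INF e\<in>{0 <..}. principal {(x, y). dist x y < e})"
definition open_ell2 :: "'a ell2 set \<Rightarrow> bool"
  where "open_ell2 S = (\<forall>x\<in>S. \<forall>\<^sub>F (x', y) in uniformity. x' = x \<longrightarrow> y \<in> S)"

lemma inner_ell2_self: "inner f f = (\<Sum>\<^sub>\<infinity>i. (cmod (coord f i))\<^sup>2)"
proof -
  have "((\<lambda>i. complex_of_real ((cmod (coord f i))\<^sup>2)) has_sum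
      complex_of_real (\<Sum>\<^sub>\<infinity>i. (cmod (coord f i))\<^sup>2)) UNIV"
    by (intro has_sum_of_real has_sum_infsum summable_coord)
  then have "(\<Sum>\<^sub>\<infinity>i. cnj (coord f i) * coord f i) = complex_of_real (\<Sum>\<^sub>\<infinity>i. (cmod (coord f i))\<^sup>2)"
    by (intro infsumI) (simp only: complex_norm_square mult.commute)
  then show ?thesis by (simp add: inner_ell2_def)
qed

instance
proof
  fix x y z :: "'a ell2" and r :: real
  show "dist x y = norm (x - y)" by (rule dist_ell2_def)
  show "sgn x = inverse (norm x) *\<^sub>R x" by (rule sgn_ell2_def)
  show "norm x = sqrt (inner x x)" by (rule norm_ell2_def)
  show "uniformity = (INF e\<in>{0 <..}. principal {(x :: 'a ell2, y). dist x y < e})"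
    by (rule uniformity_ell2_def)
  show "open S = (\<forall>x\<in>S. \<forall>\<^sub>F (x', y) in uniformity. x' = x \<longrightarrow> y \<in> S)" for S :: "'a ell2 set"
    by (rule open_ell2_def)
  have "(\<Sum>\<^sub>\<infinity>i. cnj (coord x i) * coord y i) = cnj (\<Sum>\<^sub>\<infinity>i. cnj (coord y i) * coord x i)"
    by (subst infsum_cnj[symmetric]) (simp add: mult.commute)
  then show "inner x y = inner y x"
    by (simp add: inner_ell2_def)
  show "inner (x + y) z = inner x z + inner y z"
    by (simp add: inner_ell2_def distrib_right infsum_add[OF ell2_summable ell2_summable])
  show "inner (r *\<^sub>R x) y = r * inner x y"
    by (simp add: inner_ell2_def mult.assoc infsum_cmult_right')
  show "0 \<le> inner x x"
    by (simp add: inner_ell2_self infsum_nonneg)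
  show "inner x x = 0 \<longleftrightarrow> x = 0"
  proof
    assume "inner x x = 0"
    then have "(cmod (coord x i))\<^sup>2 = 0" for i
      using nonneg_infsum_le_0D[of "\<lambda>i. (cmod (coord x i))\<^sup>2" UNIV i] summable_coord[of x]
      by (simp add: inner_ell2_self)
    then show "x = 0" by (intro ell2_eqI) simp
  qed (simp add: inner_ell2_self)
qed

end

lemma norm_ell2_sq: "(norm f)\<^sup>2 = (\<Sum>\<^sub>\<infinity>i. (cmod (coord f i))\<^sup>2)" for f :: "'a ell2"
  by (simp add: power2_norm_eq_inner inner_ell2_self)

lemma ell2_sum_le: "finite F \<Longrightarrow> (\<Sum>i\<in>F. (cmod (coord f i))\<^sup>2) \<le> (norm f)\<^sup>2"
  unfolding norm_ell2_sq by (rule finite_sum_le_infsum[OF summable_coord]) auto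

lemma cmod_coord_le: "cmod (coord f i) \<le> norm f"
  using ell2_sum_le[of "{i}" f] by (auto intro: power2_le_imp_le)

instance ell2 :: (type) complete_space
proof
  fix X :: "nat \<Rightarrow> 'a ell2"
  assume X: "Cauchy X"
  have "Cauchy (\<lambda>n. coord (X n) i)" for i
  proof (rule metric_CauchyI)
    fix e :: real assume "0 < e"
    then obtain M where M: "\<forall>m\<ge>M. \<forall>n\<ge>M. dist (X m) (X n) < e"
      using X by (meson metric_CauchyD)
    have "dist (coord (X m) i) (coord (X n) i) \<le> dist (X m) (X n)" for m n
      using cmod_coord_le[of "X m - X n" i] by (simp add: dist_norm)
    then show "\<exists>M. \<forall>m\<ge>M. \<forall>n\<ge>M. dist (coord (X m) i) (coord (X n) i) < e"
      using M by (meson le_less_trans)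
  qed
  then have "\<forall>i. \<exists>c. (\<lambda>n. coord (X n) i) \<longlonglongrightarrow> c"
    by (simp add: Cauchy_convergent_iff convergent_def)
  from choice[OF this] obtain l where l: "\<And>i. (\<lambda>n. coord (X n) i) \<longlonglongrightarrow> l i"
    by blast
  have bound: "\<exists>M. \<forall>n\<ge>M. \<forall>F. finite F \<longrightarrow> (\<Sum>i\<in>F. (cmod (coord (X n) i - l i))\<^sup>2) \<le> e\<^sup>2"
    if "0 < e" for e :: real
  proof -
    obtain M where M: "\<forall>m\<ge>M. \<forall>n\<ge>M. dist (X m) (X n) < e"
      using X \<open>0 < e\<close> by (meson metric_CauchyD)
    have "(\<Sum>i\<in>F. (cmod (coord (X n) i - l i))\<^sup>2) \<le> e\<^sup>2" if "finite F" "n \<ge> M" for F n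
    proof (rule LIMSEQ_le_const2)
      show "(\<lambda>m. \<Sum>i\<in>F. (cmod (coord (X n) i - coord (X m) i))\<^sup>2)
          \<longlonglongrightarrow> (\<Sum>i\<in>F. (cmod (coord (X n) i - l i))\<^sup>2)"
        by (intro tendsto_intros l)
      have "(\<Sum>i\<in>F. (cmod (coord (X n) i - coord (X m) i))\<^sup>2) \<le> e\<^sup>2" if "m \<ge> M" for m
      proof -
        have "(\<Sum>i\<in>F. (cmod (coord (X n) i - coord (X m) i))\<^sup>2) \<le> (dist (X n) (X m))\<^sup>2"
          using ell2_sum_le[OF \<open>finite F\<close>, of "X n - X m"] by (simp add: dist_norm)
        also have "\<dots> \<le> e\<^sup>2"
          using M that \<open>n \<ge> M\<close> by (intro power_mono) (auto intro: less_imp_le)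
        finally show ?thesis .
      qed
      then show "\<exists>N. \<forall>m\<ge>N. (\<Sum>i\<in>F. (cmod (coord (X n) i - coord (X m) i))\<^sup>2) \<le> e\<^sup>2"
        by blast
    qed
    then show ?thesis by blast
  qed
  obtain M where "\<forall>n\<ge>M. \<forall>F. finite F \<longrightarrow> (\<Sum>i\<in>F. (cmod (coord (X n) i - l i))\<^sup>2) \<le> 1"
    using bound[of 1] by auto
  then have "(\<lambda>i. (cmod (coord (X M) i - l i))\<^sup>2) summable_on UNIV"
    by (intro nonneg_bdd_above_summable_on) (auto intro!: bdd_aboveI)
  then have "(\<lambda>i. (cmod (coord (X M) i + (- 1) * (coord (X M) i - l i)))\<^sup>2) summable_on UNIV"
    by (intro summable_sq_add summable_sq_scale summable_coord)
  then have L: "coord (Abs_ell2 l) i = l i" for i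
    by (simp add: Abs_ell2_inverse)
  have "X \<longlonglongrightarrow> Abs_ell2 l"
  proof (rule metric_LIMSEQ_I)
    fix e :: real assume "0 < e"
    then obtain M where M: "\<forall>n\<ge>M. \<forall>F. finite F \<longrightarrow> (\<Sum>i\<in>F. (cmod (coord (X n) i - l i))\<^sup>2) \<le> (e/2)\<^sup>2"
      using bound[of "e/2"] by auto
    have "dist (X n) (Abs_ell2 l) < e" if "n \<ge> M" for n
    proof -
      have "(norm (X n - Abs_ell2 l))\<^sup>2 \<le> (e/2)\<^sup>2"
        unfolding norm_ell2_sq
        by (rule infsum_le_finite_sums[OF summable_coord]) (use M that in \<open>simp add: L\<close>)
      then have "norm (X n - Abs_ell2 l) \<le> e/2"
        by (rule power2_le_imp_le) (use \<open>0 < e\<close> in simp)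
      then show ?thesis using \<open>0 < e\<close> by (simp add: dist_norm)
    qed
    then show "\<exists>no. \<forall>n\<ge>no. dist (X n) (Abs_ell2 l) < e" by blast
  qed
  then show "convergent X" by (rule convergentI)
qed

instantiation ell2 :: (type) chilbert_space
begin

definition scaleC_ell2 :: "complex \<Rightarrow> 'a ell2 \<Rightarrow> 'a ell2"
  where "scaleC_ell2 a f = Abs_ell2 (\<lambda>i. a * coord f i)"
definition cinner_ell2 :: "'a ell2 \<Rightarrow> 'a ell2 \<Rightarrow> complex"
  where "cinner_ell2 f g = (\<Sum>\<^sub>\<infinity>i. cnj (coord f i) * coord g i)"

lemma coord_scaleC [simp]: "coord (a *\<^sub>C f) i = a * coord f i"
  using summable_sq_scale[OF summable_coord[of f], of a]
  by (simp add: scaleC_ell2_def Abs_ell2_inverse)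

instance
proof
  fix x y z :: "'a ell2" and a b :: complex and r :: real
  show "cinner x y = cnj (cinner y x)"
    unfolding cinner_ell2_def by (subst infsum_cnj[symmetric]) (simp add: mult.commute)
  show "cinner x (y + z) = cinner x y + cinner x z"
    by (simp add: cinner_ell2_def distrib_left infsum_add[OF ell2_summable ell2_summable])
  show "cinner x (a *\<^sub>C y) = a * cinner x y"
    by (simp add: cinner_ell2_def mult.left_commute[of _ a] infsum_cmult_right')
  show "inner x y = Re (cinner x y)"
    by (simp add: inner_ell2_def cinner_ell2_def)
qed (rule ell2_eqI, simp add: distrib_left distrib_right)+

end


section \<open>Orthonormal bases\<close>

definition orthonormal :: "'a::chilbert_space set \<Rightarrow> bool" where
  "orthonormal E \<longleftrightarrow> (\<forall>e\<in>E. \<forall>f\<in>E. cinner e f = (if e = f then 1 else 0))"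

definition onb :: "'a::chilbert_space set \<Rightarrow> 'a set \<Rightarrow> bool" where
  "onb K E \<longleftrightarrow> orthonormal E \<and> closure (cspan E) = K"

lemma norm_sq_cinner: "(norm x)\<^sup>2 = Re (cinner x x)"
  by (simp add: cinner_same)

lemma csubspace_closure:
  assumes "csubspace S"
  shows "csubspace (closure S)"
  unfolding complex_vector.subspace_def
proof (intro conjI allI ballI)
  show "0 \<in> closure S"
    using complex_vector.subspace_0[OF assms] closure_subset by blast
next
  fix x y assume "x \<in> closure S" "y \<in> closure S"
  then obtain f g where "\<forall>n. f n \<in> S" "f \<longlonglongrightarrow> x" "\<forall>n. g n \<in> S" "g \<longlonglongrightarrow> y"
    unfolding closure_sequential by blast
  then show "x + y \<in> closure S"
    unfolding closure_sequential
    by (intro exI[of _ "\<lambda>n. f n + g n"])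
       (simp add: complex_vector.subspace_add[OF assms] tendsto_add)
next
  fix c x assume "x \<in> closure S"
  then obtain f where "\<forall>n. f n \<in> S" "f \<longlonglongrightarrow> x"
    unfolding closure_sequential by blast
  then show "c *\<^sub>C x \<in> closure S"
    unfolding closure_sequential
    by (intro exI[of _ "\<lambda>n. c *\<^sub>C f n"])
       (simp add: complex_vector.subspace_scale[OF assms]
         bounded_linear.tendsto[OF bounded_linear_scaleC_right])
qed

lemma orthonormal_best_approx:
  assumes F: "finite F" "orthonormal F" and y: "y \<in> cspan F"
  shows "norm (x - (\<Sum>e\<in>F. cinner e x *\<^sub>C e)) \<le> norm (x - y)"
proof -
  define p where "p = (\<Sum>e\<in>F. cinner e x *\<^sub>C e)"
  have orth: "cinner e (x - p) = 0" if "e \<in> F" for e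
  proof -
    have "cinner e p = (\<Sum>f\<in>F. if f = e then cinner e x else 0)"
      unfolding p_def cinner_sum_right using F(2) that
      by (intro sum.cong) (auto simp: cinner_scaleC_right orthonormal_def)
    then show ?thesis using that F(1) by (simp add: cinner_diff_right)
  qed
  have "p - y \<in> cspan F"
    unfolding p_def
    by (intro complex_vector.span_diff complex_vector.span_sum complex_vector.span_scale
        complex_vector.span_base y)
  then obtain c where c: "p - y = (\<Sum>e\<in>F. c e *\<^sub>C e)"
    unfolding complex_vector.span_finite[OF F(1)] by blast
  have "cinner (p - y) (x - p) = 0"
    by (simp add: c cinner_sum_left cinner_scaleC_left orth)
  then have "inner (x - p) (p - y) = 0"
    by (simp add: inner_cinner cinner_commute[of "x - p"])
  then have "(norm (x - y))\<^sup>2 = (norm (x - p))\<^sup>2 + (norm (p - y))\<^sup>2"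
    using norm_add_Pythagorean[of "x - p" "p - y"] by (simp add: orthogonal_def)
  then have "(norm (x - p))\<^sup>2 \<le> (norm (x - y))\<^sup>2" by simp
  then show ?thesis
    unfolding p_def[symmetric] by (rule power2_le_imp_le) simp
qed

lemma onb_expansion:
  assumes E: "onb K E" and x: "x \<in> K"
  shows "((\<lambda>e. cinner e x *\<^sub>C e) has_sum x) E"
  unfolding has_sum_def
proof (rule tendstoI)
  fix \<epsilon> :: real assume "0 < \<epsilon>"
  have "x \<in> closure (cspan E)" using E x by (simp add: onb_def)
  then obtain y where y: "y \<in> cspan E" "dist y x < \<epsilon>"
    using \<open>0 < \<epsilon>\<close> closure_approachable by blast
  obtain F0 c where F0: "finite F0" "F0 \<subseteq> E" "y = (\<Sum>e\<in>F0. c e *\<^sub>C e)"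
    using y(1) unfolding complex_vector.span_explicit by blast
  have "dist (\<Sum>e\<in>F. cinner e x *\<^sub>C e) x < \<epsilon>" if F: "finite F" "F0 \<subseteq> F" "F \<subseteq> E" for F
  proof -
    have "orthonormal F" using E F(3) unfolding onb_def orthonormal_def by blast
    moreover have "y \<in> cspan F"
      unfolding F0(3) using F(2)
      by (intro complex_vector.span_sum complex_vector.span_scale complex_vector.span_base) auto
    ultimately have "norm (x - (\<Sum>e\<in>F. cinner e x *\<^sub>C e)) \<le> norm (x - y)"
      using F(1) by (intro orthonormal_best_approx)
    then show ?thesis using y(2) by (simp add: dist_norm norm_minus_commute)
  qed
  then show "\<forall>\<^sub>F F in finite_subsets_at_top E. dist (\<Sum>e\<in>F. cinner e x *\<^sub>C e) x < \<epsilon>"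
    unfolding eventually_finite_subsets_at_top using F0 by metis
qed

lemma parseval:
  assumes "onb K E" "y \<in> K"
  shows "((\<lambda>e. cnj (cinner e x) * cinner e y) has_sum cinner x y) E"
  using has_sum_bounded_linear[OF bounded_linear_cinner_right[of x] onb_expansion[OF assms]]
  by (simp add: cinner_scaleC_right cinner_commute[of x] mult.commute)

lemma exists_orthogonal_projection:
  fixes x :: "'a::chilbert_space"
  assumes L: "closed L" "csubspace L"
  obtains p where "p \<in> L" "\<And>e. e \<in> L \<Longrightarrow> cinner e (x - p) = 0"
proof -
  define d where "d = (INF y\<in>L. (norm (x - y))\<^sup>2)"
  have bdd: "bdd_below ((\<lambda>y. (norm (x - y))\<^sup>2) ` L)"
    by (rule bdd_belowI[of _ 0]) auto
  have ne: "L \<noteq> {}" using complex_vector.subspace_0[OF L(2)] by blast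
  have d_le: "d \<le> (norm (x - y))\<^sup>2" if "y \<in> L" for y
    unfolding d_def using bdd that by (rule cINF_lower)
  have "\<exists>y\<in>L. (norm (x - y))\<^sup>2 < d + inverse (real (Suc n))" for n
  proof -
    have "(INF y\<in>L. (norm (x - y))\<^sup>2) < d + inverse (real (Suc n))"
      by (simp add: d_def)
    then show ?thesis
      using cINF_less_iff[OF ne bdd] by blast
  qed
  then have "\<forall>n. \<exists>y. y \<in> L \<and> (norm (x - y))\<^sup>2 < d + inverse (real (Suc n))" by blast
  from choice[OF this] obtain y where yL: "\<And>n. y n \<in> L"
    and yd: "\<And>n. (norm (x - y n))\<^sup>2 < d + inverse (real (Suc n))" by blast
  have close: "(norm (y m - y n))\<^sup>2 \<le> 2 * inverse (real (Suc m)) + 2 * inverse (real (Suc n))" for m n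
  proof -
    define a b where "a = x - y m" and "b = x - y n"
    have "(1/2) *\<^sub>R (y m + y n) \<in> L"
      unfolding scaleR_scaleC
      by (intro complex_vector.subspace_scale complex_vector.subspace_add L yL)
    from d_le[OF this] have "d \<le> (norm ((1/2) *\<^sub>R (a + b)))\<^sup>2"
      by (simp add: a_def b_def algebra_simps flip: scaleR_add_left)
    also have "\<dots> = (norm (a + b))\<^sup>2 / 4"
      by (simp add: power_mult_distrib power_divide)
    finally have 1: "4 * d \<le> (norm (a + b))\<^sup>2" by simp
    have 2: "(norm (a - b))\<^sup>2 + (norm (a + b))\<^sup>2 = 2 * (norm a)\<^sup>2 + 2 * (norm b)\<^sup>2"
      by (simp add: power2_norm_eq_inner inner_add inner_diff inner_commute)
    have "norm (y m - y n) = norm (a - b)"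
      by (simp add: a_def b_def norm_minus_commute)
    then show ?thesis using 1 2 yd[of m] yd[of n] unfolding a_def[symmetric] b_def[symmetric]
      by (simp del: of_nat_Suc)
  qed
  have "Cauchy y"
  proof (rule metric_CauchyI)
    fix e :: real assume "0 < e"
    then obtain N where N: "inverse (real (Suc N)) < e\<^sup>2 / 4"
      using reals_Archimedean[of "e\<^sup>2 / 4"] by auto
    have "dist (y m) (y n) < e" if "m \<ge> N" "n \<ge> N" for m n
    proof -
      have "inverse (real (Suc k)) \<le> inverse (real (Suc N))" if "k \<ge> N" for k
        using that by (intro le_imp_inverse_le) auto
      from this[OF that(1)] this[OF that(2)] have "(norm (y m - y n))\<^sup>2 < e\<^sup>2"
        using close[of m n] N by linarith
      then show ?thesis
        using \<open>0 < e\<close> by (simp add: dist_norm power_less_imp_less_base)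
    qed
    then show "\<exists>M. \<forall>m\<ge>M. \<forall>n\<ge>M. dist (y m) (y n) < e" by blast
  qed
  then obtain p where p: "y \<longlonglongrightarrow> p"
    using Cauchy_convergent convergent_def by blast
  have pL: "p \<in> L"
    using closed_sequentially[OF L(1)] yL p by blast
  have "(norm (x - p))\<^sup>2 \<le> d + 0"
  proof (rule LIMSEQ_le)
    show "(\<lambda>n. (norm (x - y n))\<^sup>2) \<longlonglongrightarrow> (norm (x - p))\<^sup>2"
      by (intro tendsto_intros p)
    show "(\<lambda>n. d + inverse (real (Suc n))) \<longlonglongrightarrow> d + 0"
      by (intro tendsto_intros LIMSEQ_inverse_real_of_nat)
    show "\<exists>N. \<forall>n\<ge>N. (norm (x - y n))\<^sup>2 \<le> d + inverse (real (Suc n))"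
      using yd less_imp_le by blast
  qed
  then have pd: "(norm (x - p))\<^sup>2 \<le> d" by simp
  have "cinner e (x - p) = 0" if e: "e \<in> L" for e
  proof (cases "e = 0")
    case False
    define c where "c = cinner e (x - p) / complex_of_real ((norm e)\<^sup>2)"
    have ne: "complex_of_real ((norm e)\<^sup>2) \<noteq> 0" using False by simp
    have ce: "cinner e (x - p) = c * complex_of_real ((norm e)\<^sup>2)"
      using ne by (simp add: c_def)
    have cp: "cinner (x - p) e = cnj c * complex_of_real ((norm e)\<^sup>2)"
      by (subst cinner_commute) (simp add: ce)
    have "p + c *\<^sub>C e \<in> L"
      by (intro complex_vector.subspace_scale complex_vector.subspace_add L pL e)
    from order_trans[OF pd d_le[OF this]]
    have "(norm (x - p))\<^sup>2 \<le> (norm ((x - p) - c *\<^sub>C e))\<^sup>2"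
      by (simp only: diff_diff_eq)
    moreover have "cinner ((x - p) - c *\<^sub>C e) ((x - p) - c *\<^sub>C e)
        = cinner (x - p) (x - p) - c * cnj c * complex_of_real ((norm e)\<^sup>2)"
      unfolding cinner_diff_right[of _ "x - p"] cinner_diff_left[of "x - p"]
        cinner_scaleC_left cinner_scaleC_right ce cp cinner_same[of e]
      by (simp add: algebra_simps)
    then have "(norm ((x - p) - c *\<^sub>C e))\<^sup>2 = (norm (x - p))\<^sup>2 - (cmod c)\<^sup>2 * (norm e)\<^sup>2"
      unfolding norm_sq_cinner[of "(x - p) - c *\<^sub>C e"] norm_sq_cinner[of "x - p"]
      by (simp add: complex_norm_square[symmetric] flip: of_real_power of_real_mult)
    ultimately have "(cmod c)\<^sup>2 * (norm e)\<^sup>2 \<le> 0" by simp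
    then have "c = 0"
      using False by (simp add: mult_le_0_iff)
    then show ?thesis by (simp add: ce)
  qed simp
  then show ?thesis using that pL by blast
qed

lemma exists_onb:
  assumes K: "closed K" "csubspace K"
  shows "\<exists>E. onb K E"
proof -
  define A where "A = {E. E \<subseteq> K \<and> orthonormal E}"
  have "\<exists>M\<in>A. \<forall>X\<in>A. M \<subseteq> X \<longrightarrow> X = M"
  proof (rule subset_Zorn')
    fix C assume "subset.chain A C"
    then have C: "C \<subseteq> A" "\<And>X Y. X \<in> C \<Longrightarrow> Y \<in> C \<Longrightarrow> X \<subseteq> Y \<or> Y \<subseteq> X"
      by (auto simp: subset.chain_def)
    have "cinner e f = (if e = f then 1 else 0)" if ef: "e \<in> \<Union>C" "f \<in> \<Union>C" for e f
    proof -
      obtain X Y where X: "X \<in> C" "e \<in> X" and Y: "Y \<in> C" "f \<in> Y" using ef by blast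
      with C(2)[of X Y] obtain Z where "Z \<in> C" "e \<in> Z" "f \<in> Z" by blast
      then show ?thesis using C(1) by (auto simp: A_def orthonormal_def)
    qed
    then show "\<Union>C \<in> A" using C(1) by (auto simp: A_def orthonormal_def)
  qed
  then obtain M where M: "M \<subseteq> K" "orthonormal M"
    and max: "\<And>X. X \<subseteq> K \<Longrightarrow> orthonormal X \<Longrightarrow> M \<subseteq> X \<Longrightarrow> X = M"
    by (auto simp: A_def)
  define L where "L = closure (cspan M)"
  have L: "closed L" "csubspace L"
    by (simp_all add: L_def csubspace_closure)
  have subL: "M \<subseteq> L"
    unfolding L_def using complex_vector.span_superset closure_subset by blast
  have LK: "L \<subseteq> K"
    unfolding L_def using K M(1) by (intro closure_minimal complex_vector.span_minimal)
  have "x \<in> L" if x: "x \<in> K" for x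
  proof (rule ccontr)
    assume "x \<notin> L"
    obtain p where p: "p \<in> L" "\<And>e. e \<in> L \<Longrightarrow> cinner e (x - p) = 0"
      using exists_orthogonal_projection[OF L] by metis
    define r where "r = norm (x - p)"
    have r: "r > 0" using p(1) \<open>x \<notin> L\<close> by (auto simp: r_def)
    define z where "z = complex_of_real (1 / r) *\<^sub>C (x - p)"
    have zz: "cinner z z = 1"
      using r unfolding z_def cinner_scaleC_left cinner_scaleC_right cinner_same[of "x - p"]
        r_def[symmetric]
      by (simp add: power2_eq_square)
    have ez: "cinner e z = 0" if "e \<in> M" for e
      using p(2)[of e] subL that by (auto simp: z_def cinner_scaleC_right)
    have ze: "cinner z e = 0" if "e \<in> M" for e
      by (subst cinner_commute) (simp add: ez that)
    have "z \<in> K"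
      unfolding z_def using p(1) LK x
      by (intro complex_vector.subspace_scale complex_vector.subspace_diff K) auto
    moreover have "orthonormal (insert z M)"
      using M(2) zz ez ze by (auto simp: orthonormal_def)
    ultimately have "insert z M = M"
      using M(1) by (intro max) auto
    then show False using ez[of z] zz by auto
  qed
  then have "L = K" using LK by blast
  then show ?thesis using M(2) unfolding onb_def L_def by blast
qed


section \<open>Tensor powers\<close>

text \<open>
  The \<open>n\<close>-th Hilbert space tensor power of \<^typ>\<open>'h\<close> depends on the number \<open>n\<close>, so it is a closed
  subspace of a single Hilbert space rather than a type: the closed linear span of
  the elementary tensors. The vector \<open>x\<^sub>1 \<otimes> \<dots> \<otimes> x\<^sub>n\<close> is represented by its coordinates
  with respect to a fixed orthonormal basis of \<^typ>\<open>'h\<close>; the choice of the basis is irrelevant,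
  because the inner product of elementary tensors is the product of the
  inner products (lemma \<open>cinner_elem_tensor\<close>).
\<close>

definition basis :: "'h::chilbert_space set" where
  "basis = (SOME B. onb UNIV B)"

definition elem_tensor :: "'h::chilbert_space list \<Rightarrow> 'h list ell2" where
  "elem_tensor xs = Abs_ell2 (\<lambda>bs.
     if length bs = length xs \<and> set bs \<subseteq> basis then prod_list (map2 cinner bs xs) else 0)"

definition tensor_power :: "nat \<Rightarrow> 'h::chilbert_space list ell2 set" where
  "tensor_power n = closure (cspan {elem_tensor xs | xs. length xs = n})"

lemma onb_basis: "onb UNIV (basis :: 'h::chilbert_space set)"
  unfolding basis_def by (rule someI_ex, rule exists_onb) simp_all

lemma has_sum_elem_tensor:
  assumes "length xs = length ys"
  shows "((\<lambda>bs. cnj (prod_list (map2 cinner bs xs)) * prod_list (map2 cinner bs ys))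
    has_sum prod_list (map2 cinner xs ys)) {bs. length bs = length xs \<and> set bs \<subseteq> basis}"
  using assms
proof (induction xs ys rule: list_induct2)
  case Nil
  have "{bs :: 'a list. length bs = length ([] :: 'a list) \<and> set bs \<subseteq> basis} = {[]}" by auto
  then show ?case by (simp add: has_sum_finite_iff)
next
  case (Cons x xs y ys)
  define A where "A = {bs :: 'a list. length bs = length xs \<and> set bs \<subseteq> basis}"
  define u where "u b = cnj (cinner b x) * cinner b y" for b
  define v where "v bs = cnj (prod_list (map2 cinner bs xs)) * prod_list (map2 cinner bs ys)" for bs
  have u: "(u has_sum cinner x y) basis"
    unfolding u_def by (rule parseval[OF onb_basis]) simp
  have v: "(v has_sum prod_list (map2 cinner xs ys)) A"
    unfolding v_def A_def by (rule Cons.IH)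
  have "(\<lambda>b. norm (u b)) summable_on basis" "(\<lambda>bs. norm (v bs)) summable_on A"
    using u v has_sum_imp_summable summable_on_iff_abs_summable_on_complex by blast+
  note uv = this
  have "(\<lambda>p. norm (u (fst p) * v (snd p))) summable_on basis \<times> A"
  proof (subst Infinite_Sum.abs_summable_on_Sigma_iff, intro conjI ballI)
    show "(\<lambda>bs. norm (u (fst (b, bs)) * v (snd (b, bs)))) summable_on A" for b
      using summable_on_cmult_right[OF uv(2), of "norm (u b)"] by (simp add: norm_mult)
    show "(\<lambda>b. norm (\<Sum>\<^sub>\<infinity>bs\<in>A. norm (u (fst (b, bs)) * v (snd (b, bs))))) summable_on basis"
      using summable_on_cmult_left[OF uv(1), of "\<Sum>\<^sub>\<infinity>bs\<in>A. norm (v bs)"]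
      by (simp add: norm_mult infsum_cmult_right' infsum_nonneg abs_mult)
  qed
  then have "(\<lambda>p. u (fst p) * v (snd p)) summable_on basis \<times> A"
    by (rule abs_summable_summable)
  then have hs: "((\<lambda>p. u (fst p) * v (snd p)) has_sum cinner x y * prod_list (map2 cinner xs ys)) (basis \<times> A)"
    by (intro has_sum_SigmaI[where g = "\<lambda>b. u b * prod_list (map2 cinner xs ys)"])
       (auto intro!: has_sum_cmult_right has_sum_cmult_left u v)
  have inj: "inj_on (\<lambda>p. fst p # snd p) (basis \<times> A)"
    by (auto simp: inj_on_def)
  have img: "(\<lambda>p. fst p # snd p) ` (basis \<times> A)
      = {bs. length bs = length (x # xs) \<and> set bs \<subseteq> basis}"
  proof (intro equalityI subsetI)
    fix bs :: "'a list" assume "bs \<in> {bs. length bs = length (x # xs) \<and> set bs \<subseteq> basis}"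
    then obtain c cs where "bs = c # cs" "c \<in> basis" "cs \<in> A"
      by (cases bs) (auto simp: A_def)
    then show "bs \<in> (\<lambda>p. fst p # snd p) ` (basis \<times> A)"
      by (intro image_eqI[of _ _ "(c, cs)"]) auto
  qed (auto simp: A_def)
  have "(\<lambda>p. u (fst p) * v (snd p)) = (\<lambda>bs. cnj (prod_list (map2 cinner bs (x # xs)))
      * prod_list (map2 cinner bs (y # ys))) \<circ> (\<lambda>p. fst p # snd p)"
    by (simp add: fun_eq_iff u_def v_def mult_ac)
  from hs[unfolded this has_sum_reindex[OF inj, symmetric] img] show ?case by simp
qed

lemma coord_elem_tensor:
  "coord (elem_tensor xs) bs =
     (if length bs = length xs \<and> set bs \<subseteq> basis then prod_list (map2 cinner bs xs) else 0)"
proof -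
  define A where "A = {bs :: 'a list. length bs = length xs \<and> set bs \<subseteq> basis}"
  have "(\<lambda>bs. cnj (prod_list (map2 cinner bs xs)) * prod_list (map2 cinner bs xs)) summable_on A"
    using has_sum_elem_tensor[of xs xs] has_sum_imp_summable unfolding A_def by blast
  then have "(\<lambda>bs. (cmod (prod_list (map2 cinner bs xs)))\<^sup>2) summable_on A"
    by (subst (asm) summable_on_iff_abs_summable_on_complex) (simp add: norm_mult power2_eq_square)
  then have "(\<lambda>bs. (cmod (if length bs = length xs \<and> set bs \<subseteq> basis
      then prod_list (map2 cinner bs xs) else 0))\<^sup>2) summable_on UNIV"
    by (rule summable_on_cong_neutral[THEN iffD1, rotated -1]) (auto simp: A_def)
  then show ?thesis
    by (simp add: elem_tensor_def Abs_ell2_inverse)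
qed

lemma cinner_elem_tensor:
  assumes "length xs = length ys"
  shows "cinner (elem_tensor xs) (elem_tensor ys) = prod_list (map2 cinner xs ys)"
proof -
  have "((\<lambda>bs. cnj (coord (elem_tensor xs) bs) * coord (elem_tensor ys) bs)
      has_sum prod_list (map2 cinner xs ys)) UNIV"
    by (rule has_sum_cong_neutral[THEN iffD1, OF _ _ _ has_sum_elem_tensor[OF assms]])
       (auto simp: coord_elem_tensor assms)
  then show ?thesis
    by (simp add: cinner_ell2_def infsumI)
qed


lemma elem_tensor_scale:
  assumes "length xs = length c"
  shows "elem_tensor (map2 (*\<^sub>C) c xs) = prod_list c *\<^sub>C elem_tensor xs"
proof (rule ell2_eqI)
  fix bs :: "'a list"
  have "prod_list (map2 cinner bs (map2 (*\<^sub>C) c xs)) = prod_list c * prod_list (map2 cinner bs xs)"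
    if "length bs = length xs"
    using that assms
    by (induction bs xs c rule: list_induct3) (simp_all add: cinner_scaleC_right mult_ac)
  then show "coord (elem_tensor (map2 (*\<^sub>C) c xs)) bs = coord (prod_list c *\<^sub>C elem_tensor xs) bs"
    using assms by (simp add: coord_elem_tensor)
qed

lemma elem_tensor_in_tensor_power: "length xs = n \<Longrightarrow> elem_tensor xs \<in> tensor_power n"
  unfolding tensor_power_def
  by (rule closure_subset[THEN subsetD], rule complex_vector.span_base) blast

lemma closed_tensor_power: "closed (tensor_power n)"
  and csubspace_tensor_power: "csubspace (tensor_power n)"
  by (simp_all add: tensor_power_def csubspace_closure)


section \<open>Operators\<close>

text \<open>
  An operator on a closed subspace \<open>K\<close> is a function on the ambient type of which only the
  restriction to \<open>K\<close> matters.
\<close>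

definition bounded_operator :: "'a::chilbert_space set \<Rightarrow> ('a \<Rightarrow> 'a) \<Rightarrow> bool" where
  "bounded_operator K T \<longleftrightarrow>
     (\<forall>x\<in>K. T x \<in> K) \<and>
     (\<forall>x\<in>K. \<forall>y\<in>K. T (x + y) = T x + T y) \<and>
     (\<forall>a. \<forall>x\<in>K. T (a *\<^sub>C x) = a *\<^sub>C T x) \<and>
     (\<exists>C. \<forall>x\<in>K. norm (T x) \<le> C * norm x)"

definition positive_operator :: "'a::chilbert_space set \<Rightarrow> ('a \<Rightarrow> 'a) \<Rightarrow> bool" where
  "positive_operator K T \<longleftrightarrow> (\<forall>x\<in>K. cinner x (T x) \<in> \<real> \<and> Re (cinner x (T x)) \<ge> 0)"

text \<open>The value is independent of the orthonormal basis for trace-class \<open>T\<close>.\<close>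

definition op_trace :: "'a::chilbert_space set \<Rightarrow> ('a \<Rightarrow> 'a) \<Rightarrow> complex" where
  "op_trace K T = (\<Sum>\<^sub>\<infinity>e\<in>(SOME E. onb K E). cinner e (T e))"

definition rank_one_projection :: "('h::chilbert_space \<Rightarrow> 'h) \<Rightarrow> bool" where
  "rank_one_projection P \<longleftrightarrow>
     bounded_operator UNIV P \<and> P \<circ> P = P \<and>
     (\<forall>x y. cinner (P x) y = cinner x (P y)) \<and> cdim (range P) = 1"

text \<open>\<open>A \<otimes> \<dots> \<otimes> A\<close> is the only bounded operator with this action on elementary tensors.\<close>

definition op_tensor_power ::
    "nat \<Rightarrow> ('h::chilbert_space \<Rightarrow> 'h) \<Rightarrow> 'h list ell2 \<Rightarrow> 'h list ell2" where
  "op_tensor_power n A = (SOME B. bounded_operator (tensor_power n) B \<and>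
     (\<forall>xs. length xs = n \<longrightarrow> B (elem_tensor xs) = elem_tensor (map A xs)))"


lemma rank_one_projectionE:
  assumes "rank_one_projection P"
  obtains v where "norm v = 1" "\<And>x. P x = cinner v x *\<^sub>C v"
proof -
  have idem: "P (P x) = P x" for x
    using assms by (metis comp_apply rank_one_projection_def)
  have sa: "cinner (P x) y = cinner x (P y)" for x y
    using assms by (simp add: rank_one_projection_def)
  obtain B where B: "B \<subseteq> range P" "range P \<subseteq> cspan B" "card B = 1" "complex_vector.independent B"
    using complex_vector.basis_exists[of "range P"] assms
    by (metis rank_one_projection_def)
  then obtain w where w: "B = {w}" using card_1_singletonE by blast
  have w0: "w \<noteq> 0" using B(4) complex_vector.dependent_zero unfolding w by blast
  have Pw: "P w = w" using B(1) idem unfolding w by auto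
  define v where "v = complex_of_real (1 / norm w) *\<^sub>C w"
  have "P x = cinner v x *\<^sub>C v" for x
  proof -
    obtain c where c: "P x = c *\<^sub>C w"
      using B(2) unfolding w complex_vector.span_singleton by blast
    have "cinner w x = c * complex_of_real ((norm w)\<^sup>2)"
      using sa[of w x] by (simp add: Pw c cinner_scaleC_right cinner_same)
    then show ?thesis
      using w0 by (simp add: v_def c cinner_scaleC_left scaleC_scaleC power2_eq_square)
  qed
  moreover have "norm v = 1"
    using w0 unfolding v_def norm_scaleC norm_of_real by simp
  ultimately show ?thesis using that by blast
qed

lemma op_tensor_power_rank_one:
  assumes v: "norm v = 1" "\<And>x. P x = cinner v x *\<^sub>C v" and \<xi>: "\<xi> \<in> tensor_power n"
  shows "op_tensor_power n P \<xi>
    = cinner (elem_tensor (replicate n v)) \<xi> *\<^sub>C elem_tensor (replicate n v)"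
proof -
  define \<psi> where "\<psi> = elem_tensor (replicate n v)"
  define Q where "Q \<eta> = cinner \<psi> \<eta> *\<^sub>C \<psi>" for \<eta>
  have \<psi>: "\<psi> \<in> tensor_power n" by (simp add: \<psi>_def elem_tensor_in_tensor_power)
  have Q: "bounded_operator (tensor_power n) Q"
    unfolding bounded_operator_def
  proof (intro conjI ballI allI exI[of _ "norm \<psi> * norm \<psi>"])
    show "Q \<eta> \<in> tensor_power n" for \<eta>
      unfolding Q_def by (intro complex_vector.subspace_scale csubspace_tensor_power \<psi>)
    show "norm (Q \<eta>) \<le> norm \<psi> * norm \<psi> * norm \<eta>" for \<eta>
      using mult_right_mono[OF cmod_cinner_le[of \<psi> \<eta>] norm_ge_zero[of \<psi>]]
      by (simp add: Q_def norm_scaleC mult_ac)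
  qed (simp_all add: Q_def cinner_add_right cinner_scaleC_right scaleC_add_left scaleC_scaleC)
  have Q_elem: "Q (elem_tensor xs) = elem_tensor (map P xs)" if "length xs = n" for xs
  proof -
    have *: "map2 (*\<^sub>C) (map (cinner v) xs) (replicate n v) = map P xs"
      using that by (induction xs arbitrary: n) (auto simp: v)
    have **: "prod_list (map2 cinner (replicate n v) xs) = prod_list (map (cinner v) xs)"
      using that by (induction xs arbitrary: n) auto
    show ?thesis
      using elem_tensor_scale[of "replicate n v" "map (cinner v) xs"] that
      unfolding * by (simp add: Q_def \<psi>_def cinner_elem_tensor **)
  qed
  have unique: "B \<eta> = Q \<eta>" if B: "bounded_operator (tensor_power n) B"
    "\<forall>xs. length xs = n \<longrightarrow> B (elem_tensor xs) = elem_tensor (map P xs)"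
    and \<eta>: "\<eta> \<in> tensor_power n" for B \<eta>
  proof -
    define D where "D \<eta> = B \<eta> - Q \<eta>" for \<eta>
    define G where "G = {elem_tensor xs | xs :: 'a list. length xs = n}"
    have K: "tensor_power n = closure (cspan G)" by (simp add: tensor_power_def G_def)
    have GK: "cspan G \<subseteq> tensor_power n" unfolding K by (rule closure_subset)
    note K_simps = complex_vector.subspace_0[OF csubspace_tensor_power]
      complex_vector.subspace_add[OF csubspace_tensor_power]
      complex_vector.subspace_diff[OF csubspace_tensor_power]
    have D_add: "D (x + y) = D x + D y" if "x \<in> tensor_power n" "y \<in> tensor_power n" for x y
      using B(1) Q that by (simp add: D_def bounded_operator_def)
    have D_scale: "D (a *\<^sub>C x) = a *\<^sub>C D x" if "x \<in> tensor_power n" for a x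
      using B(1) Q that
      by (simp add: D_def bounded_operator_def complex_vector.scale_right_diff_distrib)
    obtain C1 C2 where "\<forall>x\<in>tensor_power n. norm (B x) \<le> C1 * norm x"
      "\<forall>x\<in>tensor_power n. norm (Q x) \<le> C2 * norm x"
      using B(1) Q unfolding bounded_operator_def by blast
    then have D_bound: "norm (D x) \<le> (C1 + C2) * norm x" if "x \<in> tensor_power n" for x
      using that norm_triangle_ineq4[of "B x" "Q x"] by (fastforce simp: D_def distrib_right)
    have D_0: "D 0 = 0"
      using D_bound[OF K_simps(1)] by simp
    have "x \<in> tensor_power n \<and> D x = 0" if "x \<in> cspan G" for x
      using that
    proof (induction rule: complex_vector.span_induct_alt)
      case base
      show ?case using K_simps(1) D_0 by blast
    next
      case (step c x y)
      have x: "x \<in> tensor_power n" using step(1) GK complex_vector.span_base by blast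
      have cx: "c *\<^sub>C x \<in> tensor_power n"
        by (rule complex_vector.subspace_scale[OF csubspace_tensor_power x])
      have "D x = 0"
        using step(1) B(2) by (auto simp: G_def D_def Q_elem)
      then show ?case using step(2) x cx K_simps(2)[OF cx, of y] by (simp add: D_add D_scale)
    qed
    then have D_span: "D x = 0" if "x \<in> cspan G" for x
      using that by blast
    obtain f where f: "\<forall>k. f k \<in> cspan G" "f \<longlonglongrightarrow> \<eta>"
      using \<eta> unfolding K closure_sequential by blast
    have "norm (D \<eta>) \<le> (C1 + C2) * norm (\<eta> - f k)" for k
    proof -
      have fk: "f k \<in> tensor_power n" using f(1) GK by blast
      have "D \<eta> = D (\<eta> - f k) + D (f k)"
        using D_add[OF K_simps(3)[OF \<eta> fk] fk] by simp
      then show ?thesis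
        using D_bound[OF K_simps(3)[OF \<eta> fk]] D_span f(1) by simp
    qed
    moreover have "(\<lambda>k. (C1 + C2) * norm (\<eta> - f k)) \<longlonglongrightarrow> (C1 + C2) * norm (\<eta> - \<eta>)"
      by (intro tendsto_intros f)
    ultimately have "norm (D \<eta>) \<le> (C1 + C2) * norm (\<eta> - \<eta>)"
      by (intro LIMSEQ_le_const) auto
    then show ?thesis by (simp add: D_def)
  qed
  have "\<exists>B. bounded_operator (tensor_power n) B \<and>
     (\<forall>xs. length xs = n \<longrightarrow> B (elem_tensor xs) = elem_tensor (map P xs))"
    using Q Q_elem by blast
  from someI_ex[OF this] have "op_tensor_power n P \<xi> = Q \<xi>"
    unfolding op_tensor_power_def[symmetric] using unique[OF _ _ \<xi>] by blast
  then show ?thesis by (simp add: Q_def \<psi>_def)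
qed


section \<open>Error exponents\<close>

definition is_test :: "nat \<Rightarrow> ('h::chilbert_space list ell2 \<Rightarrow> 'h list ell2) \<Rightarrow> bool" where
  "is_test n T \<longleftrightarrow> bounded_operator (tensor_power n) T \<and>
     positive_operator (tensor_power n) T \<and> positive_operator (tensor_power n) (\<lambda>x. x - T x)"

definition test_sequence :: "(nat \<Rightarrow> 'h::chilbert_space list ell2 \<Rightarrow> 'h list ell2) \<Rightarrow> bool" where
  "test_sequence T \<longleftrightarrow> (\<forall>n. is_test n (T n))"

definition alpha :: "('h::chilbert_space \<Rightarrow> 'h) set \<Rightarrow> nat \<Rightarrow> ('h list ell2 \<Rightarrow> 'h list ell2) \<Rightarrow> real" where
  "alpha R n T = Max ((\<lambda>\<rho>. Re (op_trace (tensor_power n)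
     (\<lambda>x. op_tensor_power n \<rho> (x - T x)))) ` R)"

definition beta :: "('h::chilbert_space \<Rightarrow> 'h) set \<Rightarrow> nat \<Rightarrow> ('h list ell2 \<Rightarrow> 'h list ell2) \<Rightarrow> real" where
  "beta S n T = Max ((\<lambda>\<sigma>. Re (op_trace (tensor_power n)
     (\<lambda>x. op_tensor_power n \<sigma> (T x)))) ` S)"

text \<open>The convention \<open>- log 0 = \<infinity>\<close>; in Isabelle/HOL \<open>ln 0 = 0\<close>.\<close>

definition neg_log :: "real \<Rightarrow> ereal" where
  "neg_log x = (if x = 0 then \<infinity> else ereal (- ln x))"

definition rate :: "(nat \<Rightarrow> real) \<Rightarrow> ereal" where
  "rate a = liminf (\<lambda>n. ereal (1 / real n) * neg_log (a n))"

definition stein_exponent ::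
    "('h::chilbert_space \<Rightarrow> 'h) set \<Rightarrow> ('h \<Rightarrow> 'h) set \<Rightarrow> ereal" where
  "stein_exponent R S = Sup {rate (\<lambda>n. beta S n (T n)) | T.
     test_sequence T \<and> (\<lambda>n. alpha R n (T n)) \<longlonglongrightarrow> 0}"

definition direct_exponent ::
    "real \<Rightarrow> ('h::chilbert_space \<Rightarrow> 'h) set \<Rightarrow> ('h \<Rightarrow> 'h) set \<Rightarrow> ereal" where
  "direct_exponent r R S = Sup {rate (\<lambda>n. alpha R n (T n)) | T.
     test_sequence T \<and> rate (\<lambda>n. beta S n (T n)) \<ge> ereal r}"

definition chernoff_exponent ::
    "('h::chilbert_space \<Rightarrow> 'h) set \<Rightarrow> ('h \<Rightarrow> 'h) set \<Rightarrow> ereal" where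
  "chernoff_exponent R S = Sup {ereal r | r. r \<ge> 0 \<and> (\<exists>T. test_sequence T \<and>
     rate (\<lambda>n. alpha R n (T n)) \<ge> ereal r \<and> rate (\<lambda>n. beta S n (T n)) \<ge> ereal r)}"

end

theory Submission
  imports Defs
begin

text \<open>
  Let \<open>q\<close> be the largest overlap \<open>|\<langle>v, w\<rangle>|\<^sup>2\<close> of a state in \<open>R\<close> with a state in \<open>S\<close>. Distinct
  pure states become almost orthogonal under tensor powers, so the projection onto the span of the
  powers of all states in \<open>S\<close> captures at most a constant times \<open>q\<^sup>n\<close> of any state in \<open>R\<close>; rejecting
  on it makes the second error vanish. Exchanging the roles of \<open>R\<close> and \<open>S\<close> makes the first error
  vanish. Conversely, a test on a single pair with overlap \<open>q\<close> satisfies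
  \<open>sqrt (q\<^sup>n) \<le> sqrt \<alpha> + sqrt \<beta>\<close>, hence no test beats both of these two.
\<close>

section \<open>Rates\<close>

lemma neg_log_antimono:
  assumes "0 \<le> x" "x \<le> y"
  shows "neg_log y \<le> neg_log x"
  using assms by (auto simp: neg_log_def)

lemma neg_log_power:
  assumes "0 < q" "0 < C" "0 < n"
  shows "ereal (1 / real n) * neg_log (C * q ^ n) = ereal (- (ln C * inverse (real n)) - ln q)"
  using assms by (simp add: neg_log_def ln_mult ln_realpow field_simps)

lemma neg_log_power_tendsto:
  assumes "0 < q" "0 < C"
  shows "((\<lambda>n. ereal (1 / real n) * neg_log (C * q ^ n)) \<longlongrightarrow> neg_log q) sequentially"
proof -
  have "(\<lambda>n. ereal (- (ln C * inverse (real n)) - ln q)) \<longlonglongrightarrow> ereal (- (ln C * 0) - ln q)"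
    by (intro tendsto_intros lim_inverse_n)
  moreover have "\<forall>\<^sub>F n in sequentially.
      ereal (- (ln C * inverse (real n)) - ln q) = ereal (1 / real n) * neg_log (C * q ^ n)"
    using eventually_gt_at_top[of "0::nat"]
    by eventually_elim (use assms in \<open>simp only: neg_log_power\<close>)
  ultimately have "(\<lambda>n. ereal (1 / real n) * neg_log (C * q ^ n)) \<longlonglongrightarrow> ereal (- (ln C * 0) - ln q)"
    by (rule Lim_transform_eventually)
  then show ?thesis using assms by (simp add: neg_log_def)
qed

lemma rate_antimono:
  assumes "\<forall>\<^sub>F n in sequentially. 0 \<le> a n \<and> a n \<le> b n"
  shows "rate b \<le> rate a"
  unfolding rate_def
  by (rule Liminf_mono, rule eventually_mono[OF assms])
     (auto intro!: ereal_mult_left_mono neg_log_antimono)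

lemma rate_zero: "rate (\<lambda>n. 0) = \<infinity>"
proof -
  \<comment> \<open>The index 0 must be excluded: there \<open>1 / real n\<close> is 0 and the
    product with infinity is 0.\<close>
  have "\<forall>\<^sub>F n in sequentially. ereal (1 / real n) * neg_log 0 = \<infinity>"
    using eventually_gt_at_top[of "0::nat"] by eventually_elim (simp add: neg_log_def)
  from Liminf_eq[OF this] show ?thesis
    by (simp add: rate_def Liminf_const)
qed

text \<open>The constant contributes \<open>ln C / n\<close>, which vanishes in the limit. For
  \<open>q = 0\<close> every term with positive index is 0, so both sides are infinite.\<close>

lemma rate_geometric:
  assumes "0 \<le> q" "0 < C"
  shows "rate (\<lambda>n. C * q ^ n) = neg_log q"
proof (cases "q = 0")
  case True
  have "\<forall>\<^sub>F n in sequentially. ereal (1 / real n) * neg_log (C * q ^ n)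
      = ereal (1 / real n) * neg_log 0"
    using eventually_gt_at_top[of "0::nat"] by eventually_elim (simp add: True zero_power)
  then have "rate (\<lambda>n. C * q ^ n) = rate (\<lambda>n. 0)"
    unfolding rate_def by (rule Liminf_eq)
  then show ?thesis by (simp add: rate_zero neg_log_def True)
next
  case False
  then show ?thesis
    unfolding rate_def using assms
    by (intro lim_imp_Liminf neg_log_power_tendsto) auto
qed

text \<open>Turns a rate back into an eventual exponential bound: below a liminf, \<open>t\<close>
  is eventually below \<open>- ln (a n) / n\<close>. Where \<open>a n = 0\<close> the bound is
  trivial.\<close>

lemma rate_gt_imp_le:
  assumes "ereal t < rate a" "\<And>n. 0 \<le> a n"
  shows "\<forall>\<^sub>F n in sequentially. a n \<le> exp (- t) ^ n"
proof -
  have "\<forall>\<^sub>F n in sequentially. ereal t < ereal (1 / real n) * neg_log (a n)"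
    using assms(1) unfolding rate_def by (rule less_LiminfD)
  then show ?thesis
    using eventually_gt_at_top[of "0::nat"]
  proof eventually_elim
    case (elim n)
    show ?case
    proof (cases "a n = 0")
      case False
      then have an: "0 < a n" using assms(2)[of n] by simp
      have "t < 1 / real n * (- ln (a n))"
        using elim(1) False by (simp add: neg_log_def)
      then have "ln (a n) < real n * (- t)"
        using elim(2) by (simp add: field_simps)
      then have "a n < exp (real n * (- t))"
        using an by (metis exp_less_cancel_iff exp_ln)
      then show ?thesis by (simp add: exp_of_nat_mult[symmetric])
    qed simp
  qed
qed

text \<open>If \<open>b\<close> decays strictly faster than \<open>c ^ n\<close>, then eventually
  \<open>b n \<le> c ^ n / 4\<close>. Its root uses up at most half of \<open>sqrt (c ^ n)\<close>,
  the other half falls to \<open>a n\<close>, and so \<open>a n\<close> is at least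
  \<open>c ^ n / 4\<close>. For \<open>c = 0\<close> the claimed bound is infinite.\<close>

lemma rate_tradeoff:
  assumes c: "0 \<le> c" "\<And>n. sqrt (c ^ n) \<le> sqrt (a n) + sqrt (b n)"
    and nonneg: "\<And>n. 0 \<le> a n" "\<And>n. 0 \<le> b n"
    and b: "neg_log c < rate b"
  shows "rate a \<le> neg_log c"
proof (cases "c = 0")
  case False
  with c have c0: "0 < c" by simp
  \<comment> \<open>A real rate strictly in between turns the gap into a ratio
    \<open>exp (- t) / c < 1\<close>, whose powers eventually absorb the factor 4.\<close>
  obtain t where t: "neg_log c < ereal t" "ereal t < rate b"
    using ereal_dense2[OF b] by blast
  have "- ln c < t" using t(1) c0 by (simp add: neg_log_def)
  then have "exp (- t) < c"
    using c0 by (metis exp_less_cancel_iff exp_ln minus_less_iff)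
  then have "(\<lambda>n. (exp (- t) / c) ^ n) \<longlonglongrightarrow> 0"
    using c0 by (intro LIMSEQ_realpow_zero) auto
  then have "\<forall>\<^sub>F n in sequentially. (exp (- t) / c) ^ n < 1 / 4"
    by (rule order_tendstoD) simp
  then have "\<forall>\<^sub>F n in sequentially. 0 \<le> 1 / 4 * c ^ n \<and> 1 / 4 * c ^ n \<le> a n"
    using rate_gt_imp_le[OF t(2) nonneg(2)]
  proof eventually_elim
    case (elim n)
    have "exp (- t) ^ n \<le> 1 / 4 * c ^ n"
      using elim(1) c0 by (simp add: power_divide field_simps)
    then have "b n \<le> c ^ n / 4" using elim(2) by simp
    then have "sqrt (b n) \<le> sqrt (c ^ n) / 2"
      using real_sqrt_le_mono[of "b n" "c ^ n / 4"] by (simp add: real_sqrt_divide)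
    then have "sqrt (c ^ n) / 2 \<le> sqrt (a n)"
      using c(2)[of n] by simp
    then have "(sqrt (c ^ n) / 2)\<^sup>2 \<le> (sqrt (a n))\<^sup>2"
      using c0 by (intro power_mono) auto
    then show ?case using c0 nonneg(1)[of n] by (simp add: power_divide)
  qed
  then have "rate a \<le> rate (\<lambda>n. 1 / 4 * c ^ n)" by (rule rate_antimono)
  also have "\<dots> = neg_log c" by (rule rate_geometric) (use c0 in auto)
  finally show ?thesis .
qed (simp add: neg_log_def)


section \<open>Positive operators\<close>

text \<open>Polarization: the form of \<open>A\<close> is real, and its imaginary parts at
  \<open>x + y\<close> and at \<open>x + \<i> *\<^sub>C y\<close> compare the imaginary and the real
  parts of the two mixed terms.\<close>

lemma positive_operator_hermitian:
  assumes K: "csubspace K" and A: "bounded_operator K A" "positive_operator K A"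
    and x: "x \<in> K" and y: "y \<in> K"
  shows "cinner x (A y) = cinner (A x) y"
proof -
  have im: "Im (cinner z (A z)) = 0" if "z \<in> K" for z
    using A(2) that by (auto simp: positive_operator_def complex_is_Real_iff)
  have add: "A (z + w) = A z + A w" if "z \<in> K" "w \<in> K" for z w
    using A(1) that by (simp add: bounded_operator_def)
  have scale: "A (c *\<^sub>C z) = c *\<^sub>C A z" if "z \<in> K" for z c
    using A(1) that by (simp add: bounded_operator_def)
  have iy: "\<i> *\<^sub>C y \<in> K" by (rule complex_vector.subspace_scale[OF K y])
  have "Im (cinner x (A y)) + Im (cinner y (A x)) = 0"
    using im[OF complex_vector.subspace_add[OF K x y]] im[OF x] im[OF y]
    by (simp add: add[OF x y] cinner_add_left cinner_add_right)
  moreover have "Re (cinner x (A y)) - Re (cinner y (A x)) = 0"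
    using im[OF complex_vector.subspace_add[OF K x iy]] im[OF x] im[OF y]
    by (simp add: add[OF x iy] scale[OF y] cinner_add_left cinner_add_right
        cinner_scaleC_left cinner_scaleC_right)
  ultimately have "cinner x (A y) = cnj (cinner y (A x))"
    by (simp add: complex_eq_iff)
  then show ?thesis by (metis cinner_commute)
qed

text \<open>
  The Cauchy--Schwarz inequality for the form of \<open>A\<close>. As its second factor is at most \<open>1\<close>, it
  suffices to expand the form at \<open>x - \<langle>y, A x\<rangle> y\<close>.
\<close>

lemma positive_operator_cinner_le:
  assumes K: "csubspace K" and A: "bounded_operator K A" "positive_operator K A"
    and x: "x \<in> K" and y: "y \<in> K" and y1: "Re (cinner y (A y)) \<le> 1"
  shows "(cmod (cinner y (A x)))\<^sup>2 \<le> Re (cinner x (A x))"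
proof -
  define h where "h = cinner y (A x)"
  have h': "cinner x (A y) = cnj h"
    unfolding h_def by (metis cinner_commute positive_operator_hermitian[OF K A x y])
  define z where "z = (- h) *\<^sub>C y"
  have z: "z \<in> K" unfolding z_def by (rule complex_vector.subspace_scale[OF K y])
  have Az: "A z = (- h) *\<^sub>C A y" unfolding z_def using A(1) y unfolding bounded_operator_def by blast
  have Axz: "A (x + z) = A x + A z" using A(1) x z by (simp add: bounded_operator_def)
  have hh: "h * cnj h = complex_of_real ((cmod h)\<^sup>2)" by (rule complex_norm_square[symmetric])
  have "cinner (x + z) (A (x + z))
      = cinner x (A x) - h * cnj h - h * cnj h + h * cnj h * cinner y (A y)"
    unfolding Axz Az cinner_add_left cinner_add_right
    by (simp add: z_def cinner_scaleC_left cinner_scaleC_right cinner_minus_left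
        cinner_minus_right h' h_def[symmetric])
  then have "Re (cinner (x + z) (A (x + z)))
      = Re (cinner x (A x)) - 2 * (cmod h)\<^sup>2 + (cmod h)\<^sup>2 * Re (cinner y (A y))"
    unfolding hh by simp
  moreover have "Re (cinner (x + z) (A (x + z))) \<ge> 0"
    using A(2) complex_vector.subspace_add[OF K x z] by (simp add: positive_operator_def)
  moreover have "(cmod h)\<^sup>2 * Re (cinner y (A y)) \<le> (cmod h)\<^sup>2 * 1"
    using y1 by (intro mult_left_mono) auto
  ultimately show ?thesis by (simp add: h_def)
qed

lemma bounded_operator_complement:
  assumes "csubspace K" "bounded_operator K T"
  shows "bounded_operator K (\<lambda>x. x - T x)"
proof -
  obtain C where C: "\<forall>x\<in>K. norm (T x) \<le> C * norm x"
    using assms(2) by (auto simp: bounded_operator_def)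
  have "norm (x - T x) \<le> (1 + C) * norm x" if "x \<in> K" for x
    using C that norm_triangle_ineq4[of x "T x"] by (fastforce simp: distrib_right)
  then show ?thesis
    using assms(2) complex_vector.subspace_diff[OF assms(1)]
    by (auto simp: bounded_operator_def complex_vector.scale_right_diff_distrib)
qed

lemma is_test_complement:
  assumes "is_test n T"
  shows "is_test n (\<lambda>x. x - T x)"
  using assms by (simp add: is_test_def bounded_operator_complement csubspace_tensor_power)


section \<open>Error probabilities of pure states\<close>

abbreviation tensor_vec :: "nat \<Rightarrow> 'h::chilbert_space \<Rightarrow> 'h list ell2" where
  "tensor_vec n v \<equiv> elem_tensor (replicate n v)"

lemma cinner_tensor_vec: "cinner (tensor_vec n v) (tensor_vec n w) = cinner v w ^ n"
proof -
  have "prod_list (map2 cinner (replicate n v) (replicate n w)) = cinner v w ^ n"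
    by (induction n) auto
  then show ?thesis by (simp add: cinner_elem_tensor)
qed

lemma tensor_vec_in: "tensor_vec n v \<in> tensor_power n"
  by (simp add: elem_tensor_in_tensor_power)

lemma cinner_tensor_vec_same: "norm v = 1 \<Longrightarrow> cinner (tensor_vec n v) (tensor_vec n v) = 1"
  unfolding cinner_tensor_vec by (simp add: cinner_same)

text \<open>The tensor power of \<open>P\<close> is the projection onto the product vector. Since
  \<open>A\<close> is hermitian, the diagonal entry at a basis vector \<open>e\<close> is a product
  of coefficients of \<open>A ?\<psi>\<close> and \<open>?\<psi>\<close>, and Parseval's identity
  sums these entries.\<close>

lemma op_trace_rank_one:
  assumes v: "norm v = 1" "\<And>x. P x = cinner v x *\<^sub>C v"
    and A: "bounded_operator (tensor_power n) A" "positive_operator (tensor_power n) A"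
  shows "op_trace (tensor_power n) (\<lambda>x. op_tensor_power n P (A x))
    = cinner (tensor_vec n v) (A (tensor_vec n v))"
proof -
  let ?K = "tensor_power n :: 'a list ell2 set" and ?\<psi> = "tensor_vec n v"
  define E where "E = (SOME E. onb ?K E)"
  have E: "onb ?K E"
    unfolding E_def
    by (rule someI_ex, rule exists_onb) (rule closed_tensor_power csubspace_tensor_power)+
  have EK: "E \<subseteq> ?K"
    using E complex_vector.span_superset closure_subset unfolding onb_def by blast
  have eq: "cinner e (op_tensor_power n P (A e)) = cnj (cinner e (A ?\<psi>)) * cinner e ?\<psi>"
    if "e \<in> E" for e
  proof -
    have e: "e \<in> ?K" using EK that by blast
    then have "A e \<in> ?K" using A(1) by (simp add: bounded_operator_def)
    then have "op_tensor_power n P (A e) = cinner ?\<psi> (A e) *\<^sub>C ?\<psi>"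
      by (rule op_tensor_power_rank_one[OF v])
    moreover have "cinner ?\<psi> (A e) = cnj (cinner e (A ?\<psi>))"
      by (metis cinner_commute positive_operator_hermitian[OF csubspace_tensor_power A tensor_vec_in e])
    ultimately show ?thesis by (simp add: cinner_scaleC_right)
  qed
  have "((\<lambda>e. cnj (cinner e (A ?\<psi>)) * cinner e ?\<psi>) has_sum cinner (A ?\<psi>) ?\<psi>) E"
    by (rule parseval[OF E tensor_vec_in])
  then have "op_trace ?K (\<lambda>x. op_tensor_power n P (A x)) = cinner (A ?\<psi>) ?\<psi>"
    unfolding op_trace_def E_def[symmetric]
    by (subst infsum_cong[OF eq]) (simp_all add: infsumI)
  then show ?thesis
    by (simp add: positive_operator_hermitian[OF csubspace_tensor_power A tensor_vec_in tensor_vec_in])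
qed

text \<open>The vector is determined only up to a phase. Acceptance probabilities of tests and
  overlaps do not depend on that phase.\<close>

definition state_vec :: "('h::chilbert_space \<Rightarrow> 'h) \<Rightarrow> 'h" where
  "state_vec P = (SOME v. norm v = 1 \<and> (\<forall>x. P x = cinner v x *\<^sub>C v))"

lemma state_vec:
  assumes "rank_one_projection P"
  shows "norm (state_vec P) = 1" "P x = cinner (state_vec P) x *\<^sub>C state_vec P"
proof -
  have "\<exists>v. norm v = 1 \<and> (\<forall>x. P x = cinner v x *\<^sub>C v)"
    using rank_one_projectionE[OF assms] by metis
  from someI_ex[OF this] show "norm (state_vec P) = 1" "P x = cinner (state_vec P) x *\<^sub>C state_vec P"
    unfolding state_vec_def by blast+
qed

text \<open>For a test \<open>T\<close> and a pure state \<open>P\<close> this is the trace of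
  \<open>T\<close> against the \<open>n\<close>-th tensor power of \<open>P\<close>, the probability
  of deciding for the first hypothesis.\<close>

definition accept :: "nat \<Rightarrow> ('h::chilbert_space list ell2 \<Rightarrow> 'h list ell2) \<Rightarrow> ('h \<Rightarrow> 'h) \<Rightarrow> real" where
  "accept n T P = Re (cinner (tensor_vec n (state_vec P)) (T (tensor_vec n (state_vec P))))"

lemma beta_eq:
  assumes "is_test n T" "\<And>\<sigma>. \<sigma> \<in> S \<Longrightarrow> rank_one_projection \<sigma>"
  shows "beta S n T = Max (accept n T ` S)"
proof -
  have "Re (op_trace (tensor_power n) (\<lambda>x. op_tensor_power n \<sigma> (T x))) = accept n T \<sigma>"
    if "\<sigma> \<in> S" for \<sigma>
    using assms(1) op_trace_rank_one[OF state_vec[OF assms(2)[OF that]]]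
    by (simp add: is_test_def accept_def)
  then show ?thesis by (simp add: beta_def)
qed

lemma beta_singleton:
  "is_test n T \<Longrightarrow> rank_one_projection \<sigma> \<Longrightarrow> beta {\<sigma>} n T = accept n T \<sigma>"
  by (subst beta_eq) auto

text \<open>Passing to the complementary test exchanges the two errors, so that facts on
  \<open>beta\<close> carry over to \<open>alpha\<close>.\<close>

lemma alpha_eq_beta: "alpha R n T = beta R n (\<lambda>x. x - T x)"
  by (simp add: alpha_def beta_def)

lemma alpha_complement: "alpha R n (\<lambda>x. x - T x) = beta R n T"
  by (simp add: alpha_def beta_def)

lemma accept_nonneg: "is_test n T \<Longrightarrow> 0 \<le> accept n T P"
  by (simp add: is_test_def positive_operator_def accept_def tensor_vec_in)

lemma accept_complement:
  assumes "rank_one_projection P"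
  shows "accept n (\<lambda>x. x - T x) P = 1 - accept n T P"
  by (simp add: accept_def cinner_diff_right cinner_tensor_vec_same state_vec(1)[OF assms])

lemma accept_le_1:
  assumes "is_test n T" "rank_one_projection P"
  shows "accept n T P \<le> 1"
  using accept_nonneg[OF is_test_complement[OF assms(1)], of P] accept_complement[OF assms(2), of n T]
  by simp

lemma beta_nonneg:
  assumes "is_test n T" "finite S" "S \<noteq> {}" "\<And>\<sigma>. \<sigma> \<in> S \<Longrightarrow> rank_one_projection \<sigma>"
  shows "0 \<le> beta S n T"
  using assms accept_nonneg[OF assms(1)] by (simp add: beta_eq Max_ge_iff ex_in_conv)

lemma beta_mono:
  assumes "is_test n T" "finite S" "\<sigma> \<in> S" "\<And>\<sigma>. \<sigma> \<in> S \<Longrightarrow> rank_one_projection \<sigma>"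
  shows "beta {\<sigma>} n T \<le> beta S n T"
  using assms by (simp add: beta_eq[OF assms(1)] beta_singleton)

lemma alpha_nonneg:
  assumes "is_test n T" "finite R" "R \<noteq> {}" "\<And>\<rho>. \<rho> \<in> R \<Longrightarrow> rank_one_projection \<rho>"
  shows "0 \<le> alpha R n T"
  unfolding alpha_eq_beta by (intro beta_nonneg is_test_complement assms)

lemma alpha_mono:
  assumes "is_test n T" "finite R" "\<rho> \<in> R" "\<And>\<rho>. \<rho> \<in> R \<Longrightarrow> rank_one_projection \<rho>"
  shows "alpha {\<rho>} n T \<le> alpha R n T"
  unfolding alpha_eq_beta by (intro beta_mono is_test_complement assms)

section \<open>Transition probabilities of pure states and the trade-off between the errors\<close>

definition overlap :: "('h::chilbert_space \<Rightarrow> 'h) \<Rightarrow> ('h \<Rightarrow> 'h) \<Rightarrow> real" where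
  "overlap P Q = (cmod (cinner (state_vec P) (state_vec Q)))\<^sup>2"

lemma overlap_nonneg: "0 \<le> overlap P Q"
  by (simp add: overlap_def)

lemma overlap_commute: "overlap P Q = overlap Q P"
  unfolding overlap_def by (subst cinner_commute) simp

lemma overlap_le_1:
  assumes "rank_one_projection P" "rank_one_projection Q"
  shows "overlap P Q \<le> 1"
  using cmod_cinner_le[of "state_vec P" "state_vec Q"] assms
  by (simp add: overlap_def state_vec(1) power_le_one)

text \<open>The equality case of Cauchy-Schwarz: the state vectors differ by a phase, which cancels
  in the projections. Hence distinct states have overlap below 1, and the overlap of their tensor
  powers tends to 0.\<close>

lemma overlap_eq_1_imp_eq:
  assumes P: "rank_one_projection P" and Q: "rank_one_projection Q" and 1: "overlap P Q = 1"
  shows "P = Q"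
proof
  fix x
  define v w where "v = state_vec P" and "w = state_vec Q"
  define c where "c = cinner v w"
  have cc: "c * cnj c = 1"
    using 1 unfolding c_def v_def w_def overlap_def complex_norm_square[symmetric] by simp
  have wv: "cinner w v = cnj c" unfolding c_def by (rule cinner_commute)
  have vv: "cinner v v = 1" "cinner w w = 1"
    using state_vec(1)[OF P] state_vec(1)[OF Q] by (simp_all add: cinner_same v_def w_def)
  have "cinner (w - c *\<^sub>C v) (w - c *\<^sub>C v) = 0"
    using cc by (simp add: cinner_diff_left cinner_diff_right cinner_scaleC_left cinner_scaleC_right
        vv wv c_def[symmetric] mult.commute)
  then have w: "w = c *\<^sub>C v" by (simp add: cinner_same)
  have "cinner w x *\<^sub>C w = (cnj c * cinner v x * c) *\<^sub>C v"
    by (simp add: w cinner_scaleC_left scaleC_scaleC)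
  also have "cnj c * cinner v x * c = cinner v x"
    using cc by (metis mult.assoc mult.commute mult.left_neutral)
  finally show "P x = Q x"
    by (simp add: state_vec(2)[OF P] state_vec(2)[OF Q] v_def w_def)
qed

text \<open>Split the inner product of the two product vectors along \<open>I = (I - T) + T\<close>.
  The Cauchy-Schwarz inequality for the form of \<open>I - T\<close> bounds one part by the first
  error, the one for the form of \<open>T\<close> bounds the other part by the second error.\<close>

lemma sqrt_overlap_le:
  assumes T: "is_test n T" and P: "rank_one_projection P" and Q: "rank_one_projection Q"
  shows "sqrt (overlap P Q ^ n) \<le> sqrt (alpha {P} n T) + sqrt (beta {Q} n T)"
proof -
  define v w where "v = tensor_vec n (state_vec P)" and "w = tensor_vec n (state_vec Q)"
  note K = csubspace_tensor_power[of n]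
  have v: "v \<in> tensor_power n" and w: "w \<in> tensor_power n"
    by (simp_all add: v_def w_def tensor_vec_in)
  note T' = is_test_complement[OF T]
  have "(cmod (cinner w (v - T v)))\<^sup>2 \<le> Re (cinner v (v - T v))"
    using T' accept_le_1[OF T' Q]
    by (intro positive_operator_cinner_le[OF K _ _ v w]) (simp_all add: is_test_def accept_def w_def)
  moreover have "(cmod (cinner v (T w)))\<^sup>2 \<le> Re (cinner w (T w))"
    using T accept_le_1[OF T P]
    by (intro positive_operator_cinner_le[OF K _ _ w v]) (simp_all add: is_test_def accept_def v_def)
  moreover have "alpha {P} n T = Re (cinner v (v - T v))" "beta {Q} n T = Re (cinner w (T w))"
    using T T' P Q by (simp_all add: alpha_eq_beta beta_singleton accept_def v_def w_def)
  ultimately have 1: "cmod (cinner w (v - T v)) \<le> sqrt (alpha {P} n T)"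
    and 2: "cmod (cinner v (T w)) \<le> sqrt (beta {Q} n T)"
    by (simp_all add: real_le_rsqrt)
  \<comment> \<open>Moving \<open>T\<close> onto \<open>w\<close> makes the second summand one that
    is controlled by the acceptance probability of \<open>Q\<close>, not by that of
    \<open>P\<close>.\<close>
  have "cinner v (T w) = cnj (cinner w (T v))"
    by (metis T cinner_commute is_test_def positive_operator_hermitian[OF K _ _ v w])
  then have "cmod (cinner w v) \<le> cmod (cinner w (v - T v)) + cmod (cinner v (T w))"
    using norm_triangle_ineq[of "cinner w (v - T v)" "cinner w (T v)"]
    by (simp add: cinner_diff_right)
  moreover have "sqrt (overlap P Q ^ n) = cmod (cinner w v)"
    unfolding overlap_commute[of P Q]
    by (simp add: v_def w_def cinner_tensor_vec overlap_def norm_power real_sqrt_power)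
  ultimately show ?thesis using 1 2 by linarith
qed


section \<open>Projections onto almost orthogonal families\<close>

definition proj :: "'a::chilbert_space set \<Rightarrow> 'a \<Rightarrow> 'a" where
  "proj L x = (SOME p. p \<in> L \<and> (\<forall>e\<in>L. cinner e (x - p) = 0))"

context
  fixes L :: "'a::chilbert_space set"
  assumes L: "closed L" "csubspace L"
begin

lemma proj_in: "proj L x \<in> L"
  and proj_orth: "e \<in> L \<Longrightarrow> cinner e (x - proj L x) = 0"
proof -
  have "\<exists>p. p \<in> L \<and> (\<forall>e\<in>L. cinner e (x - p) = 0)"
    using exists_orthogonal_projection[OF L, of x] by metis
  from someI_ex[OF this] show "proj L x \<in> L" "e \<in> L \<Longrightarrow> cinner e (x - proj L x) = 0"
    unfolding proj_def by blast+
qed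

text \<open>Two candidates differ by a vector of \<open>L\<close> that is orthogonal to
  \<open>L\<close>, hence to itself. This uniqueness gives the algebraic rules
  \<open>proj_id\<close>, \<open>proj_add\<close> and \<open>proj_scale\<close>.\<close>

lemma proj_eqI:
  assumes "p \<in> L" "\<And>e. e \<in> L \<Longrightarrow> cinner e (x - p) = 0"
  shows "proj L x = p"
proof -
  define d where "d = p - proj L x"
  have "d \<in> L" unfolding d_def by (intro complex_vector.subspace_diff L(2) assms(1) proj_in)
  then have "cinner d (x - proj L x) - cinner d (x - p) = 0"
    by (simp add: assms(2) proj_orth)
  then have "cinner d d = 0" by (simp add: cinner_diff_right d_def)
  then show ?thesis by (simp add: cinner_same d_def)
qed

lemma proj_id: "x \<in> L \<Longrightarrow> proj L x = x"
  by (rule proj_eqI) auto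

lemma proj_add: "proj L (x + y) = proj L x + proj L y"
proof (rule proj_eqI)
  show "proj L x + proj L y \<in> L"
    by (intro complex_vector.subspace_add L(2) proj_in)
  show "cinner e (x + y - (proj L x + proj L y)) = 0" if "e \<in> L" for e
    using proj_orth[OF that, of x] proj_orth[OF that, of y]
    by (simp add: cinner_diff_right cinner_add_right)
qed

lemma proj_scale: "proj L (a *\<^sub>C x) = a *\<^sub>C proj L x"
proof (rule proj_eqI)
  show "a *\<^sub>C proj L x \<in> L"
    by (intro complex_vector.subspace_scale L(2) proj_in)
  show "cinner e (a *\<^sub>C x - a *\<^sub>C proj L x) = 0" if "e \<in> L" for e
    using proj_orth[OF that, of x] by (simp add: cinner_diff_right cinner_scaleC_right)
qed

lemma cinner_proj: "cinner x (proj L x) = complex_of_real ((norm (proj L x))\<^sup>2)"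
proof -
  have "cinner (proj L x) x = cinner (proj L x) (proj L x)"
    using proj_orth[OF proj_in, of x x] by (simp add: cinner_diff_right)
  then show ?thesis
    by (metis cinner_commute cinner_same complex_cnj_complex_of_real)
qed

lemma cinner_proj_complement:
  "cinner x (x - proj L x) = complex_of_real ((norm (x - proj L x))\<^sup>2)"
proof -
  have "cinner (x - proj L x) (x - proj L x) = cinner x (x - proj L x)"
    by (simp add: cinner_diff_left proj_orth proj_in)
  then show ?thesis by (simp add: cinner_same)
qed

lemma norm_proj_le: "norm (proj L x) \<le> norm x"
proof -
  have "norm (proj L x) * norm (proj L x) \<le> norm x * norm (proj L x)"
    using cmod_cinner_le[of x "proj L x"] unfolding cinner_proj norm_of_real
    by (simp add: power2_eq_square)
  then show ?thesis by (cases "proj L x = 0") auto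
qed

end

lemma is_test_proj:
  assumes L: "closed L" "csubspace L" and n: "L \<subseteq> tensor_power n"
  shows "is_test n (proj L)"
  unfolding is_test_def bounded_operator_def positive_operator_def
  using n proj_in[OF L] norm_proj_le[OF L]
  by (auto simp: proj_add[OF L] proj_scale[OF L] cinner_proj[OF L] cinner_proj_complement[OF L]
      simp flip: of_real_power intro!: exI[of _ 1])

text \<open>The Gram matrix is close to the identity: its off-diagonal entries are at most
  \<open>1 / (2 * card F)\<close> in modulus, so they cost at most half of the sum of
  squares.\<close>

lemma almost_orthogonal_norm:
  assumes F: "finite F" "\<And>f. f \<in> F \<Longrightarrow> norm f = 1"
    and orth: "\<And>f g. f \<in> F \<Longrightarrow> g \<in> F \<Longrightarrow> f \<noteq> g \<Longrightarrow> 2 * real (card F) * cmod (cinner f g) \<le> 1"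
  shows "(\<Sum>f\<in>F. (cmod (a f))\<^sup>2) \<le> 2 * (norm (\<Sum>f\<in>F. a f *\<^sub>C f))\<^sup>2"
proof (cases "F = {}")
  case False
  define k where "k = real (card F)"
  have k: "0 < k" using F(1) False by (simp add: k_def card_gt_0_iff)
  define s where "s = (\<Sum>f\<in>F. (cmod (a f))\<^sup>2)"
  \<comment> \<open>On the diagonal this gives something away, but it makes the estimate uniform
    over all pairs. Summed over the \<open>k * k\<close> pairs, the subtracted terms give exactly
    \<open>s / 2\<close>.\<close>
  have entry: "(if f = g then (cmod (a f))\<^sup>2 else 0) - ((cmod (a f))\<^sup>2 + (cmod (a g))\<^sup>2) / (4 * k)
      \<le> Re (cnj (a f) * (a g * cinner f g))" if f: "f \<in> F" and g: "g \<in> F" for f g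
  proof (cases "f = g")
    case True
    have "cinner f f = 1" by (simp add: cinner_same F(2)[OF f])
    then have "cnj (a f) * (a f * cinner f f) = complex_of_real ((cmod (a f))\<^sup>2)"
      by (simp only: mult_1_right complex_norm_square) (rule mult.commute)
    then show ?thesis using True k by simp
  next
    case False
    define p q where "p = cmod (a f)" and "q = cmod (a g)"
    have "cmod (cinner f g) \<le> 1 / (2 * k)"
      using orth[OF f g False] k by (simp add: k_def field_simps)
    then have "p * (q * cmod (cinner f g)) \<le> p * (q * (1 / (2 * k)))"
      by (intro mult_left_mono) (simp_all add: p_def q_def)
    moreover have "p * (q * (1 / (2 * k))) \<le> (p\<^sup>2 + q\<^sup>2) / (4 * k)"
      using sum_squares_bound[of p q] k by (simp add: field_simps)
    moreover have "- Re (cnj (a f) * (a g * cinner f g)) \<le> p * (q * cmod (cinner f g))"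
      using abs_Re_le_cmod[of "cnj (a f) * (a g * cinner f g)"]
      by (simp add: norm_mult p_def q_def)
    ultimately show ?thesis using False by (simp add: p_def q_def)
  qed
  have "s - s / 2 = (\<Sum>f\<in>F. \<Sum>g\<in>F. (if f = g then (cmod (a f))\<^sup>2 else 0)
      - ((cmod (a f))\<^sup>2 + (cmod (a g))\<^sup>2) / (4 * k))"
    using k F(1)
    by (simp add: sum_subtractf sum.distrib s_def[symmetric] k_def[symmetric]
        flip: sum_divide_distrib sum_distrib_left)
  also have "\<dots> \<le> (\<Sum>f\<in>F. \<Sum>g\<in>F. Re (cnj (a f) * (a g * cinner f g)))"
    by (intro sum_mono entry)
  also have "\<dots> = (norm (\<Sum>f\<in>F. a f *\<^sub>C f))\<^sup>2"
    unfolding norm_sq_cinner cinner_sum_left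
    by (simp only: cinner_sum_right cinner_scaleC_left cinner_scaleC_right Re_sum
        mult.left_commute)
  finally show ?thesis by (simp add: s_def)
qed simp

text \<open>A substitute for Bessel's inequality with constant 2. The coefficients of a vector in
  the span are controlled by its norm, which bounds its inner product with \<open>x\<close>; applied
  to the projection \<open>p\<close> of \<open>x\<close>, where that inner product is the squared
  norm of \<open>p\<close>, this leaves the claim after cancellation.\<close>

lemma norm_proj_span_le:
  assumes F: "finite F" "\<And>f. f \<in> F \<Longrightarrow> norm f = 1"
    and orth: "\<And>f g. f \<in> F \<Longrightarrow> g \<in> F \<Longrightarrow> f \<noteq> g \<Longrightarrow> 2 * real (card F) * cmod (cinner f g) \<le> 1"
  shows "(norm (proj (closure (cspan F)) x))\<^sup>2 \<le> 2 * (\<Sum>f\<in>F. (cmod (cinner f x))\<^sup>2)"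
proof -
  define M where "M = (\<Sum>f\<in>F. (cmod (cinner f x))\<^sup>2)"
  \<comment> \<open>The desired inequality is a closed condition on \<open>y\<close>, so it passes
    from the span to its closure, where the projection lies.\<close>
  define D where "D = {y. (cmod (cinner y x))\<^sup>2 \<le> 2 * (norm y)\<^sup>2 * M}"
  have "cspan F \<subseteq> D"
  proof
    fix y assume "y \<in> cspan F"
    then obtain a where y: "y = (\<Sum>f\<in>F. a f *\<^sub>C f)"
      unfolding complex_vector.span_finite[OF F(1)] by blast
    have "cmod (cinner y x) \<le> (\<Sum>f\<in>F. cmod (a f) * cmod (cinner f x))"
      unfolding y cinner_sum_left cinner_scaleC_left
      by (rule order_trans[OF norm_sum]) (simp add: norm_mult)
    then have "(cmod (cinner y x))\<^sup>2 \<le> (\<Sum>f\<in>F. cmod (a f) * cmod (cinner f x))\<^sup>2"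
      by (intro power_mono) auto
    also have "\<dots> \<le> (\<Sum>f\<in>F. (cmod (a f))\<^sup>2) * M"
      unfolding M_def by (rule Cauchy_Schwarz_ineq_sum)
    also have "\<dots> \<le> 2 * (norm y)\<^sup>2 * M"
      unfolding y by (intro mult_right_mono almost_orthogonal_norm F orth)
        (auto simp: M_def sum_nonneg)
    finally show "y \<in> D" by (simp add: D_def)
  qed
  moreover have "closed D"
    unfolding D_def
    by (intro closed_Collect_le continuous_intros
        linear_continuous_on[OF bounded_linear_cinner_left])
  ultimately have sub: "closure (cspan F) \<subseteq> D" by (rule closure_minimal)
  define L where "L = closure (cspan F)"
  have L: "closed L" "csubspace L"
    by (simp_all add: L_def csubspace_closure complex_vector.subspace_span)
  define p where "p = proj L x"
  have "p \<in> D" using proj_in[OF L, of x] sub by (auto simp: p_def L_def)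
  moreover have "cmod (cinner p x) = (norm p)\<^sup>2"
    by (subst cinner_commute) (simp add: p_def cinner_proj[OF L] norm_power)
  ultimately have "(norm p)\<^sup>2 * (norm p)\<^sup>2 \<le> (2 * M) * (norm p)\<^sup>2"
    by (simp add: D_def power2_eq_square mult_ac)
  moreover have "0 \<le> M" by (auto simp: M_def sum_nonneg)
  ultimately have "(norm p)\<^sup>2 \<le> 2 * M"
    using mult_right_le_imp_le[of "(norm p)\<^sup>2" "(norm p)\<^sup>2" "2 * M"] by (cases "p = 0") auto
  then show ?thesis by (simp add: p_def L_def M_def)
qed

text \<open>\<open>Q n\<close> projects onto the span of the \<open>n\<close>-th tensor powers of
  all states in \<open>S\<close>. It fixes each of them, and once these vectors are almost
  orthogonal, \<open>norm_proj_span_le\<close> bounds its action on any other state.\<close>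

lemma asymptotic_projection:
  fixes S :: "('h::chilbert_space \<Rightarrow> 'h) set"
  assumes S: "finite S" "\<And>\<sigma>. \<sigma> \<in> S \<Longrightarrow> rank_one_projection \<sigma>"
  obtains Q where "\<forall>n. is_test n (Q n)" "\<forall>n. \<forall>\<sigma>\<in>S. accept n (Q n) \<sigma> = 1"
    "\<forall>\<^sub>F n in sequentially. \<forall>\<rho>. accept n (Q n) \<rho> \<le> 2 * (\<Sum>\<sigma>\<in>S. overlap \<sigma> \<rho> ^ n)"
proof
  define F where "F n = (\<lambda>\<sigma>. tensor_vec n (state_vec \<sigma>)) ` S" for n
  define L where "L n = closure (cspan (F n))" for n
  have L: "closed (L n)" "csubspace (L n)" for n
    by (simp_all add: L_def csubspace_closure complex_vector.subspace_span)
  have FL: "F n \<subseteq> L n" for n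
    unfolding L_def using complex_vector.span_superset closure_subset by blast
  have "L n \<subseteq> tensor_power n" for n
    unfolding L_def
    by (intro closure_minimal complex_vector.span_minimal closed_tensor_power csubspace_tensor_power)
       (auto simp: F_def tensor_vec_in)
  then show "\<forall>n. is_test n (proj (L n))"
    by (intro allI is_test_proj L)
  show "\<forall>n. \<forall>\<sigma>\<in>S. accept n (proj (L n)) \<sigma> = 1"
  proof (intro allI ballI)
    fix n \<sigma> assume "\<sigma> \<in> S"
    have "tensor_vec n (state_vec \<sigma>) \<in> L n" using FL \<open>\<sigma> \<in> S\<close> by (auto simp: F_def)
    then show "accept n (proj (L n)) \<sigma> = 1"
      using state_vec(1)[OF S(2)[OF \<open>\<sigma> \<in> S\<close>]]
      by (simp add: accept_def proj_id[OF L] cinner_tensor_vec_same)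
  qed
  \<comment> \<open>Inner products of tensor powers are \<open>n\<close>-th powers of numbers of
    modulus below 1. As there are finitely many pairs, one threshold for \<open>n\<close> serves all
    of them.\<close>
  have "\<forall>\<^sub>F n in sequentially. \<forall>\<sigma>\<in>S. \<forall>\<tau>\<in>S. \<sigma> \<noteq> \<tau> \<longrightarrow>
      2 * real (card S) * cmod (cinner (state_vec \<sigma>) (state_vec \<tau>)) ^ n \<le> 1"
  proof (intro eventually_ball_finite S(1) ballI)
    fix \<sigma> \<tau> assume \<sigma>: "\<sigma> \<in> S" and \<tau>: "\<tau> \<in> S"
    let ?c = "cmod (cinner (state_vec \<sigma>) (state_vec \<tau>))"
    show "\<forall>\<^sub>F n in sequentially. \<sigma> \<noteq> \<tau> \<longrightarrow> 2 * real (card S) * ?c ^ n \<le> 1"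
    proof (cases "\<sigma> = \<tau>")
      case False
      then have "?c\<^sup>2 < 1"
        using overlap_eq_1_imp_eq[OF S(2)[OF \<sigma>] S(2)[OF \<tau>]]
          overlap_le_1[OF S(2)[OF \<sigma>] S(2)[OF \<tau>]]
        by (fastforce simp: overlap_def)
      then have "?c < 1" by (simp add: power_less_one_iff)
      then have "(\<lambda>n. 2 * real (card S) * ?c ^ n) \<longlonglongrightarrow> 2 * real (card S) * 0"
        by (intro tendsto_intros LIMSEQ_realpow_zero) auto
      then have "\<forall>\<^sub>F n in sequentially. 2 * real (card S) * ?c ^ n < 1"
        by (rule order_tendstoD) simp
      then show ?thesis by (rule eventually_mono) auto
    qed simp
  qed
  then show "\<forall>\<^sub>F n in sequentially. \<forall>\<rho>.
      accept n (proj (L n)) \<rho> \<le> 2 * (\<Sum>\<sigma>\<in>S. overlap \<sigma> \<rho> ^ n)"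
  proof (rule eventually_mono, intro allI)
    fix n and \<rho> :: "'h \<Rightarrow> 'h"
    assume small: "\<forall>\<sigma>\<in>S. \<forall>\<tau>\<in>S. \<sigma> \<noteq> \<tau> \<longrightarrow>
      2 * real (card S) * cmod (cinner (state_vec \<sigma>) (state_vec \<tau>)) ^ n \<le> 1"
    define x where "x = tensor_vec n (state_vec \<rho>)"
    have fin: "finite (F n)" by (simp add: F_def S)
    have one: "norm f = 1" if "f \<in> F n" for f
    proof -
      have "cinner f f = 1"
        using that state_vec(1)[OF S(2)] by (auto simp: F_def cinner_tensor_vec_same)
      then have "complex_of_real ((norm f)\<^sup>2) = complex_of_real 1" by (simp only: cinner_same of_real_1)
      then have "(norm f)\<^sup>2 = 1" by (simp only: of_real_eq_iff)
      then show ?thesis by (simp add: power2_eq_1_iff) (use norm_ge_zero[of f] in linarith)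
    qed
    have orth: "2 * real (card (F n)) * cmod (cinner f g) \<le> 1"
      if fg: "f \<in> F n" "g \<in> F n" "f \<noteq> g" for f g
    proof -
      obtain \<sigma> \<tau> where \<sigma>: "\<sigma> \<in> S" "f = tensor_vec n (state_vec \<sigma>)"
        and \<tau>: "\<tau> \<in> S" "g = tensor_vec n (state_vec \<tau>)"
        using fg by (auto simp: F_def)
      have "card (F n) \<le> card S" unfolding F_def by (rule card_image_le[OF S(1)])
      then have "2 * real (card (F n)) * cmod (cinner f g) \<le> 2 * real (card S) * cmod (cinner f g)"
        by (intro mult_right_mono) auto
      also have "\<dots> \<le> 1"
        using small \<sigma> \<tau> fg(3) by (auto simp: cinner_tensor_vec norm_power)
      finally show ?thesis .
    qed
    have "accept n (proj (L n)) \<rho> = (norm (proj (L n) x))\<^sup>2"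
      unfolding accept_def x_def[symmetric] cinner_proj[OF L] by simp
    also have "\<dots> \<le> 2 * (\<Sum>f\<in>F n. (cmod (cinner f x))\<^sup>2)"
      unfolding L_def by (rule norm_proj_span_le[OF fin one orth])
    also have "(\<Sum>f\<in>F n. (cmod (cinner f x))\<^sup>2)
        \<le> (\<Sum>\<sigma>\<in>S. (cmod (cinner (tensor_vec n (state_vec \<sigma>)) x))\<^sup>2)"
      using sum_image_le[OF S(1), of "\<lambda>f. (cmod (cinner f x))\<^sup>2"
          "\<lambda>\<sigma>. tensor_vec n (state_vec \<sigma>)"]
      by (simp add: F_def o_def)
    also have "\<dots> = (\<Sum>\<sigma>\<in>S. overlap \<sigma> \<rho> ^ n)"
      by (simp add: x_def cinner_tensor_vec overlap_def norm_power power_mult[symmetric] mult.commute)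
    finally show "accept n (proj (L n)) \<rho> \<le> 2 * (\<Sum>\<sigma>\<in>S. overlap \<sigma> \<rho> ^ n)" by simp
  qed
qed

text \<open>Here \<open>S\<close> is the hypothesis that is never rejected and \<open>R\<close> the
  one wrongly accepted, with \<open>C = 2 * card S\<close>. The main theorem uses this in both
  orders of the two sets.\<close>

lemma asymptotic_projection_error:
  fixes R S :: "('h::chilbert_space \<Rightarrow> 'h) set"
  assumes S: "finite S" "S \<noteq> {}" "\<And>\<sigma>. \<sigma> \<in> S \<Longrightarrow> rank_one_projection \<sigma>"
    and R: "finite R" "R \<noteq> {}" "\<And>\<rho>. \<rho> \<in> R \<Longrightarrow> rank_one_projection \<rho>"
    and q: "\<And>\<rho> \<sigma>. \<rho> \<in> R \<Longrightarrow> \<sigma> \<in> S \<Longrightarrow> overlap \<rho> \<sigma> \<le> q"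
  obtains Q C where "test_sequence Q" "\<forall>n. alpha S n (Q n) = 0" "0 < C"
    "\<forall>\<^sub>F n in sequentially. beta R n (Q n) \<le> C * q ^ n"
proof -
  obtain Q where "\<forall>n. is_test n (Q n)" "\<forall>n. \<forall>\<sigma>\<in>S. accept n (Q n) \<sigma> = 1"
    and Q_le: "\<forall>\<^sub>F n in sequentially. \<forall>\<rho>. accept n (Q n) \<rho> \<le> 2 * (\<Sum>\<sigma>\<in>S. overlap \<sigma> \<rho> ^ n)"
    using asymptotic_projection[OF S(1,3)] by blast
  then have Q: "is_test n (Q n)" "\<sigma> \<in> S \<Longrightarrow> accept n (Q n) \<sigma> = 1" for n \<sigma>
    by blast+
  have "accept n (\<lambda>x. x - Q n x) \<sigma> = 0" if "\<sigma> \<in> S" for n \<sigma>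
    by (simp add: accept_complement[OF S(3)[OF that]] Q(2)[OF that])
  then have "accept n (\<lambda>x. x - Q n x) ` S = {0}" for n
    using S(2) by auto
  then have "alpha S n (Q n) = 0" for n
    by (simp add: alpha_eq_beta beta_eq[OF is_test_complement[OF Q(1)] S(3)])
  moreover have "\<forall>\<^sub>F n in sequentially. beta R n (Q n) \<le> (2 * real (card S)) * q ^ n"
    using Q_le
  proof eventually_elim
    case (elim n)
    have "accept n (Q n) \<rho> \<le> 2 * real (card S) * q ^ n" if \<rho>: "\<rho> \<in> R" for \<rho>
    proof -
      have "(\<Sum>\<sigma>\<in>S. overlap \<sigma> \<rho> ^ n) \<le> real (card S) * q ^ n"
        using q[OF \<rho>] by (intro sum_bounded_above power_mono) (auto simp: overlap_commute overlap_nonneg)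
      then show ?thesis using elim[rule_format, of \<rho>] by simp
    qed
    then show ?case using R by (simp add: beta_eq[OF Q(1)])
  qed
  moreover have "0 < 2 * real (card S)" using S by (simp add: card_gt_0_iff)
  ultimately show ?thesis
    using that[of Q "2 * real (card S)"] Q(1) by (simp add: test_sequence_def)
qed


section \<open>Exponents\<close>

theorem mainTheorem11:
  fixes R S :: "('h::chilbert_space \<Rightarrow> 'h) set"
  assumes "finite R" and "R \<noteq> {}" and "finite S" and "S \<noteq> {}"
    and "\<And>\<rho>. \<rho> \<in> R \<Longrightarrow> rank_one_projection \<rho>"
    and "\<And>\<sigma>. \<sigma> \<in> S \<Longrightarrow> rank_one_projection \<sigma>"
  shows "stein_exponent R S = Min ((\<lambda>(\<rho>, \<sigma>). stein_exponent {\<rho>} {\<sigma>}) ` (R \<times> S)) \<and>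
    chernoff_exponent R S = Min ((\<lambda>(\<rho>, \<sigma>). chernoff_exponent {\<rho>} {\<sigma>}) ` (R \<times> S)) \<and>
    (\<forall>r>0. direct_exponent r R S = Min ((\<lambda>(\<rho>, \<sigma>). direct_exponent r {\<rho>} {\<sigma>}) ` (R \<times> S)))"
proof -
  note R = assms(1,2,5) and S = assms(3,4,6)
  have fin: "finite (R \<times> S)" "R \<times> S \<noteq> {}" using assms by auto
  define q where "q = Max ((\<lambda>(\<rho>, \<sigma>). overlap \<rho> \<sigma>) ` (R \<times> S))"
  have "q \<in> (\<lambda>(\<rho>, \<sigma>). overlap \<rho> \<sigma>) ` (R \<times> S)"
    unfolding q_def using fin by (intro Max_in) auto
  \<comment> \<open>The pair of largest overlap is the hardest to distinguish; it attains all three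
    minima.\<close>
  then obtain \<rho> \<sigma> where \<rho>: "\<rho> \<in> R" and \<sigma>: "\<sigma> \<in> S" and q: "q = overlap \<rho> \<sigma>" by auto
  have q_ge: "overlap \<rho>' \<sigma>' \<le> q" if "\<rho>' \<in> R" "\<sigma>' \<in> S" for \<rho>' \<sigma>'
    unfolding q_def using fin that by (intro Max_ge) auto
  have q_ge_sym: "overlap \<sigma>' \<rho>' \<le> q" if "\<sigma>' \<in> S" "\<rho>' \<in> R" for \<rho>' \<sigma>'
    using q_ge[OF that(2,1)] by (simp only: overlap_commute)
  have q01: "0 \<le> q" "q \<le> 1"
    using overlap_nonneg overlap_le_1[OF R(3)[OF \<rho>] S(3)[OF \<sigma>]] by (simp_all add: q)

  \<comment> \<open>The errors of the sets dominate those of every pair. This gives the easy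
    inequality, that no pair has a smaller exponent than the sets.\<close>
  have rates: "rate (\<lambda>n. alpha R n (T n)) \<le> rate (\<lambda>n. alpha {\<rho>'} n (T n))"
    "rate (\<lambda>n. beta S n (T n)) \<le> rate (\<lambda>n. beta {\<sigma>'} n (T n))"
    if T: "test_sequence T" and "\<rho>' \<in> R" "\<sigma>' \<in> S" for T \<rho>' \<sigma>'
  proof -
    have t: "is_test n (T n)" for n using T by (simp add: test_sequence_def)
    show "rate (\<lambda>n. alpha R n (T n)) \<le> rate (\<lambda>n. alpha {\<rho>'} n (T n))"
      using that R by (intro rate_antimono always_eventually allI conjI alpha_nonneg alpha_mono t) auto
    show "rate (\<lambda>n. beta S n (T n)) \<le> rate (\<lambda>n. beta {\<sigma>'} n (T n))"
      using that S by (intro rate_antimono always_eventually allI conjI beta_nonneg beta_mono t) auto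
  qed

  \<comment> \<open>The first test is the complement of the projection for \<open>S\<close>, the
    second the projection for \<open>R\<close>. The bound \<open>C * q ^ n\<close> on the first
    error of the former tends to 0 only when \<open>q < 1\<close>.\<close>
  have tests: "\<exists>T. test_sequence T \<and> (\<forall>n. beta S n (T n) = 0) \<and>
      rate (\<lambda>n. alpha R n (T n)) \<ge> neg_log q \<and> (q < 1 \<longrightarrow> (\<lambda>n. alpha R n (T n)) \<longlonglongrightarrow> 0)"
    "\<exists>T. test_sequence T \<and> (\<forall>n. alpha R n (T n) = 0) \<and> rate (\<lambda>n. beta S n (T n)) \<ge> neg_log q"
  proof -
    obtain Q C where Q: "test_sequence Q" "\<forall>n. alpha S n (Q n) = 0" "0 < C"
      and le: "\<forall>\<^sub>F n in sequentially. beta R n (Q n) \<le> C * q ^ n"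
      using asymptotic_projection_error[OF S R q_ge] by blast
    define T where "T n x = x - Q n x" for n x
    have a: "alpha R n (T n) = beta R n (Q n)" and b: "beta S n (T n) = 0" for n
      using Q(2) by (simp_all add: T_def[abs_def] alpha_complement flip: alpha_eq_beta)
    have nonneg: "0 \<le> beta R n (Q n)" for n
      using Q(1) R by (intro beta_nonneg) (auto simp: test_sequence_def)
    have "rate (\<lambda>n. C * q ^ n) \<le> rate (\<lambda>n. alpha R n (T n))"
      unfolding a using le nonneg by (intro rate_antimono) (auto elim: eventually_mono)
    moreover have "(\<lambda>n. alpha R n (T n)) \<longlonglongrightarrow> 0" if "q < 1"
    proof (rule tendsto_sandwich[of "\<lambda>_. 0"])
      have "(\<lambda>n. C * q ^ n) \<longlonglongrightarrow> C * 0"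
        using that q01 by (intro tendsto_intros LIMSEQ_realpow_zero)
      then show "(\<lambda>n. C * q ^ n) \<longlonglongrightarrow> 0" by simp
    qed (use le nonneg in \<open>auto simp: a\<close>)
    moreover have "test_sequence T"
      using Q(1) is_test_complement by (auto simp: test_sequence_def T_def[abs_def])
    ultimately show "\<exists>T. test_sequence T \<and> (\<forall>n. beta S n (T n) = 0) \<and>
      rate (\<lambda>n. alpha R n (T n)) \<ge> neg_log q \<and> (q < 1 \<longrightarrow> (\<lambda>n. alpha R n (T n)) \<longlonglongrightarrow> 0)"
      using b rate_geometric[OF q01(1) Q(3)] by auto
  next
    obtain Q C where Q: "test_sequence Q" "\<forall>n. alpha R n (Q n) = 0" "0 < C"
      and le: "\<forall>\<^sub>F n in sequentially. beta S n (Q n) \<le> C * q ^ n"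
      using asymptotic_projection_error[OF R S q_ge_sym] by blast
    have "0 \<le> beta S n (Q n)" for n
      using Q(1) S by (intro beta_nonneg) (auto simp: test_sequence_def)
    then have "rate (\<lambda>n. C * q ^ n) \<le> rate (\<lambda>n. beta S n (Q n))"
      using le by (intro rate_antimono) (auto elim: eventually_mono)
    then show "\<exists>T. test_sequence T \<and> (\<forall>n. alpha R n (T n) = 0) \<and>
        rate (\<lambda>n. beta S n (T n)) \<ge> neg_log q"
      using Q rate_geometric[OF q01(1) Q(3)] by auto
  qed
  obtain A where A: "test_sequence A" "\<And>n. beta S n (A n) = 0"
    "rate (\<lambda>n. alpha R n (A n)) \<ge> neg_log q" "q < 1 \<Longrightarrow> (\<lambda>n. alpha R n (A n)) \<longlonglongrightarrow> 0"
    using tests(1) by blast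
  obtain B where B: "test_sequence B" "\<And>n. alpha R n (B n) = 0"
    "rate (\<lambda>n. beta S n (B n)) \<ge> neg_log q"
    using tests(2) by blast
  have pair_nonneg: "0 \<le> alpha {\<rho>} n (T n)" "0 \<le> beta {\<sigma>} n (T n)"
    and pair_sqrt: "sqrt (q ^ n) \<le> sqrt (alpha {\<rho>} n (T n)) + sqrt (beta {\<sigma>} n (T n))"
    if "test_sequence T" for T n
    using that R(3)[OF \<rho>] S(3)[OF \<sigma>]
    by (auto simp: test_sequence_def q intro!: alpha_nonneg beta_nonneg sqrt_overlap_le)
  have tradeoff: "rate (\<lambda>n. alpha {\<rho>} n (T n)) \<le> neg_log q"
    if "test_sequence T" "neg_log q < rate (\<lambda>n. beta {\<sigma>} n (T n))" for T
    using rate_tradeoff[OF q01(1) pair_sqrt pair_nonneg, OF that(1) that(1) that(1) that(2)] .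

  \<comment> \<open>Common to all exponents: besides the easy inequality, only the extremal pair has
    to be compared with the sets.\<close>
  have Min: "e R S = Min ((\<lambda>(\<rho>, \<sigma>). e {\<rho>} {\<sigma>}) ` (R \<times> S))"
    if "\<And>\<rho>' \<sigma>'. \<rho>' \<in> R \<Longrightarrow> \<sigma>' \<in> S \<Longrightarrow> e R S \<le> e {\<rho>'} {\<sigma>'}" "e {\<rho>} {\<sigma>} \<le> e R S"
    for e :: "('h \<Rightarrow> 'h) set \<Rightarrow> ('h \<Rightarrow> 'h) set \<Rightarrow> ereal"
  proof (rule Min_eqI[symmetric])
    have "e R S = e {\<rho>} {\<sigma>}" using that \<rho> \<sigma> by (intro antisym)
    then show "e R S \<in> (\<lambda>(\<rho>, \<sigma>). e {\<rho>} {\<sigma>}) ` (R \<times> S)" using \<rho> \<sigma> by auto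
  qed (use that fin in auto)

  have "stein_exponent R S = Min ((\<lambda>(\<rho>, \<sigma>). stein_exponent {\<rho>} {\<sigma>}) ` (R \<times> S))"
  proof (rule Min)
    fix \<rho>' \<sigma>' assume pair: "\<rho>' \<in> R" "\<sigma>' \<in> S"
    show "stein_exponent R S \<le> stein_exponent {\<rho>'} {\<sigma>'}"
      unfolding stein_exponent_def
    proof (rule Sup_mono, clarify)
      fix T assume T: "test_sequence T" "(\<lambda>n. alpha R n (T n)) \<longlonglongrightarrow> 0"
      then have t: "is_test n (T n)" for n by (simp add: test_sequence_def)
      have "(\<lambda>n. alpha {\<rho>'} n (T n)) \<longlonglongrightarrow> 0"
        using pair R
        by (intro tendsto_sandwich[OF _ _ tendsto_const T(2)] always_eventually allI
            alpha_nonneg alpha_mono t) auto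
      then show "\<exists>y\<in>{rate (\<lambda>n. beta {\<sigma>'} n (T n)) |T.
          test_sequence T \<and> (\<lambda>n. alpha {\<rho>'} n (T n)) \<longlonglongrightarrow> 0}. rate (\<lambda>n. beta S n (T n)) \<le> y"
        using T(1) rates(2)[OF T(1) pair] by blast
    qed
  next
    show "stein_exponent {\<rho>} {\<sigma>} \<le> stein_exponent R S"
    \<comment> \<open>For \<open>q < 1\<close> the test \<open>A\<close> makes the second error
      zero, so the exponent of the sets is infinite. For \<open>q = 1\<close> the pair has exponent
      at most 0, and \<open>B\<close> shows that the sets reach at least 0.\<close>
    proof (cases "q < 1")
      case True
      have "rate (\<lambda>n. beta S n (A n)) \<le> stein_exponent R S"
        unfolding stein_exponent_def using A True by (intro Sup_upper) blast
      then show ?thesis by (simp add: A(2) rate_zero)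
    next
      case False
      then have q1: "q = 1" using q01 by simp
      have "stein_exponent {\<rho>} {\<sigma>} \<le> 0"
        unfolding stein_exponent_def
      proof (rule Sup_least, clarify)
        fix T assume T: "test_sequence T" "(\<lambda>n. alpha {\<rho>} n (T n)) \<longlonglongrightarrow> 0"
        have "\<forall>\<^sub>F n in sequentially. alpha {\<rho>} n (T n) < 1 / 4"
          using T(2) by (rule order_tendstoD) simp
        \<comment> \<open>With \<open>q = 1\<close> the roots of the errors add up to at least 1, so
          a first error below 1/4 forces a second one of at least 1/4. The factor
          \<open>1 ^ n\<close> brings the constant into the form of
          \<open>rate_geometric\<close>.\<close>
        then have "\<forall>\<^sub>F n in sequentially. 0 \<le> 1 / 4 * (1 :: real) ^ n \<and> 1 / 4 * 1 ^ n \<le> beta {\<sigma>} n (T n)"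
        proof eventually_elim
          case (elim n)
          have "sqrt (alpha {\<rho>} n (T n)) \<le> sqrt (1 / 4)"
            using elim by (intro real_sqrt_le_mono) simp
          then have "1 / 2 \<le> sqrt (beta {\<sigma>} n (T n))"
            using pair_sqrt[OF T(1), of n] by (simp add: q1 real_sqrt_divide)
          then have "(1 / 2)\<^sup>2 \<le> beta {\<sigma>} n (T n)"
            by (intro sqrt_ge_absD) simp
          then show ?case by (simp add: power2_eq_square)
        qed
        then have "rate (\<lambda>n. beta {\<sigma>} n (T n)) \<le> rate (\<lambda>n. 1 / 4 * 1 ^ n)"
          by (rule rate_antimono)
        also have "\<dots> = 0"
          by (subst rate_geometric) (auto simp: neg_log_def)
        finally show "rate (\<lambda>n. beta {\<sigma>} n (T n)) \<le> 0" .
      qed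
      also have "0 \<le> rate (\<lambda>n. beta S n (B n))"
        using B(3) by (simp add: q1 neg_log_def zero_ereal_def)
      also have "\<dots> \<le> stein_exponent R S"
        unfolding stein_exponent_def using B by (intro Sup_upper) auto
      finally show ?thesis .
    qed
  qed
  moreover have "chernoff_exponent R S = Min ((\<lambda>(\<rho>, \<sigma>). chernoff_exponent {\<rho>} {\<sigma>}) ` (R \<times> S))"
  proof (rule Min)
    fix \<rho>' \<sigma>' assume pair: "\<rho>' \<in> R" "\<sigma>' \<in> S"
    show "chernoff_exponent R S \<le> chernoff_exponent {\<rho>'} {\<sigma>'}"
      unfolding chernoff_exponent_def
      by (rule Sup_subset_mono) (blast intro: order_trans rates[OF _ pair])
  next
    \<comment> \<open>Otherwise the second error would decay faster than \<open>q ^ n\<close>, and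
      \<open>tradeoff\<close> would keep the first rate, hence \<open>r\<close>, at or below
      \<open>neg_log q\<close>.\<close>
    have "ereal r \<le> neg_log q" if "test_sequence T" "ereal r \<le> rate (\<lambda>n. alpha {\<rho>} n (T n))"
      "ereal r \<le> rate (\<lambda>n. beta {\<sigma>} n (T n))" for r T
      using tradeoff[OF that(1)] that(2,3) by (meson not_le order_trans less_le_trans)
    \<comment> \<open>Conversely \<open>A\<close> achieves each such \<open>r\<close>: its first
      rate is at least \<open>neg_log q\<close> and its second is infinite.\<close>
    moreover have "\<exists>T. test_sequence T \<and> ereal r \<le> rate (\<lambda>n. alpha R n (T n)) \<and>
        ereal r \<le> rate (\<lambda>n. beta S n (T n))" if "ereal r \<le> neg_log q" for r
      using A(1) order_trans[OF that A(3)] by (intro exI[of _ A]) (simp add: A(2) rate_zero)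
    ultimately show "chernoff_exponent {\<rho>} {\<sigma>} \<le> chernoff_exponent R S"
      unfolding chernoff_exponent_def by (intro Sup_subset_mono) blast
  qed
  moreover have "direct_exponent r R S = Min ((\<lambda>(\<rho>, \<sigma>). direct_exponent r {\<rho>} {\<sigma>}) ` (R \<times> S))" for r
  proof (rule Min)
    fix \<rho>' \<sigma>' assume pair: "\<rho>' \<in> R" "\<sigma>' \<in> S"
    show "direct_exponent r R S \<le> direct_exponent r {\<rho>'} {\<sigma>'}"
      unfolding direct_exponent_def
      by (rule Sup_mono) (blast intro: order_trans rates[OF _ pair])
  next
    show "direct_exponent r {\<rho>} {\<sigma>} \<le> direct_exponent r R S"
    \<comment> \<open>If \<open>r\<close> is at most \<open>neg_log q\<close>, then \<open>B\<close>
      is admissible and has first error zero. If \<open>r\<close> is larger, \<open>tradeoff\<close>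
      limits every admissible test on the pair to \<open>neg_log q\<close>, a rate that
      \<open>A\<close> guarantees for the sets.\<close>
    proof (cases "ereal r \<le> neg_log q")
      case True
      have "rate (\<lambda>n. alpha R n (B n)) \<le> direct_exponent r R S"
        unfolding direct_exponent_def using B(1) order_trans[OF True B(3)]
        by (intro Sup_upper) blast
      then show ?thesis by (simp add: B(2) rate_zero)
    next
      case False
      have "direct_exponent r {\<rho>} {\<sigma>} \<le> neg_log q"
        unfolding direct_exponent_def using False
        by (intro Sup_least) (auto intro!: tradeoff)
      also have "\<dots> \<le> rate (\<lambda>n. alpha R n (A n))" by (rule A(3))
      also have "\<dots> \<le> direct_exponent r R S"
        unfolding direct_exponent_def using A(1)
        by (intro Sup_upper) (auto simp: A(2) rate_zero intro!: exI[of _ A])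
      finally show ?thesis .
    qed
  qed
  ultimately show ?thesis by blast
qed

end
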